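(* Let $V>0$. If the infimum defining $F_s(V)$ is attained, i.e. if $F_s(V)=E_V(u^\ast,h^\ast)+S_V(h^\ast)$ for some $(u^\ast,h^\ast)\in\mathcal{A}_V$, then the set $\{h^\ast>0\}$ is connected.
   Context: For a nonnegative $h\in H^1(\mathbb{R})$ (identified with its continuous representative), let $\Omega_h:=\{(x,y)\in\mathbb{R}^2: 0<y<h(x)\}$. For $V>0$, let $\mathcal{A}_V$ be the set of pairs $(u,h)$ with $h\in H^1(\mathbb{R})$, $h\ge 0$, $u\in H^1(\Omega_h)$ real-valued, $\int_{\mathbb{R}}h\,dx=V$, and $u(x,0)=x$ (in the sense of traces) for $x\in\operatorname{supp}h$. Set $$E_V(u,h):=\int_{\Omega_h}|\nabla u|^2\,dx\,dy,\qquad S_V(h):=\int_{\mathbb{R}}h'^2\,dx,\qquad F_s(V):=\inf\{E_V(u,h)+S_V(h): (u,h)\in\mathcal{A}_V\}.$$ *)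

theory Defs
  imports "HOL-Analysis.Analysis"
begin

primrec C_k :: "nat \<Rightarrow> ('a::euclidean_space \<Rightarrow> real) \<Rightarrow> bool" where
  "C_k 0 f \<longleftrightarrow> continuous_on UNIV f"
| "C_k (Suc k) f \<longleftrightarrow> (\<forall>x. f differentiable (at x)) \<and>
     (\<forall>b\<in>Basis. C_k k (\<lambda>x. frechet_derivative f (at x) b))"

definition smooth_function :: "('a::euclidean_space \<Rightarrow> real) \<Rightarrow> bool" where
  "smooth_function f \<longleftrightarrow> (\<forall>k. C_k k f)"

definition test_function :: "'a set \<Rightarrow> ('a::euclidean_space \<Rightarrow> real) \<Rightarrow> bool" where
  "test_function \<Omega> \<phi> \<longleftrightarrow> smooth_function \<phi> \<and>
     compact (closure {x. \<phi> x \<noteq> 0}) \<and> closure {x. \<phi> x \<noteq> 0} \<subseteq> \<Omega>"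

definition locally_integrable ::
    "'a set \<Rightarrow> ('a::euclidean_space \<Rightarrow> 'b::euclidean_space) \<Rightarrow> bool" where
  "locally_integrable \<Omega> f \<longleftrightarrow> (\<forall>K\<subseteq>\<Omega>. compact K \<longrightarrow> set_integrable lebesgue K f)"

definition is_weak_gradient ::
    "'a set \<Rightarrow> ('a::euclidean_space \<Rightarrow> real) \<Rightarrow> ('a \<Rightarrow> 'a) \<Rightarrow> bool" where
  "is_weak_gradient \<Omega> u g \<longleftrightarrow>
     locally_integrable \<Omega> u \<and> locally_integrable \<Omega> g \<and>
     (\<forall>\<phi>. test_function \<Omega> \<phi> \<longrightarrow> (\<forall>b\<in>Basis.
        (LINT x:\<Omega>|lebesgue. u x * frechet_derivative \<phi> (at x) b) =
        - (LINT x:\<Omega>|lebesgue. (g x \<bullet> b) * \<phi> x)))"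

text \<open>The weak gradient is determined only up to null sets, so \<open>weak_grad\<close> picks one
  representative; it is used below only inside integrals.  In dimension one
  (\<open>'a = real\<close>, with basis \<open>{1}\<close>) it is the weak derivative.\<close>

definition weak_grad :: "'a set \<Rightarrow> ('a::euclidean_space \<Rightarrow> real) \<Rightarrow> 'a \<Rightarrow> 'a" where
  "weak_grad \<Omega> u = (SOME g. is_weak_gradient \<Omega> u g)"

definition in_L2 :: "'a set \<Rightarrow> ('a::euclidean_space \<Rightarrow> 'b::euclidean_space) \<Rightarrow> bool" where
  "in_L2 \<Omega> f \<longleftrightarrow> set_borel_measurable lebesgue \<Omega> f \<and>
     set_integrable lebesgue \<Omega> (\<lambda>x. (norm (f x))\<^sup>2)"

text \<open>Functions are total; only their values on \<open>\<Omega>\<close> matter.\<close>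

definition in_H1 :: "'a set \<Rightarrow> ('a::euclidean_space \<Rightarrow> real) \<Rightarrow> bool" where
  "in_H1 \<Omega> u \<longleftrightarrow> in_L2 \<Omega> u \<and> (\<exists>g. is_weak_gradient \<Omega> u g \<and> in_L2 \<Omega> g)"

definition dirichlet_energy :: "'a set \<Rightarrow> ('a::euclidean_space \<Rightarrow> real) \<Rightarrow> real" where
  "dirichlet_energy \<Omega> u = (LINT x:\<Omega>|lebesgue. (norm (weak_grad \<Omega> u x))\<^sup>2)"

definition H1_norm_sq :: "'a set \<Rightarrow> ('a::euclidean_space \<Rightarrow> real) \<Rightarrow> real" where
  "H1_norm_sq \<Omega> u = (LINT x:\<Omega>|lebesgue. (u x)\<^sup>2) + dirichlet_energy \<Omega> u"

definition Omega :: "(real \<Rightarrow> real) \<Rightarrow> (real \<times> real) set" where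
  "Omega h = {(x, y). 0 < y \<and> y < h x}"

text \<open>The trace on the bottom side of the rectangle \<open>(a,b) \<times> (0,d)\<close>: the trace operator
  is the continuous extension, from \<open>H\<^sup>1\<close> to \<open>L\<^sup>2(a,b)\<close>, of the restriction
  \<open>\<phi> \<mapsto> \<phi>(\<cdot>,0)\<close> of functions that are smooth up to the boundary.\<close>

definition has_bottom_trace ::
    "real \<Rightarrow> real \<Rightarrow> real \<Rightarrow> (real \<times> real \<Rightarrow> real) \<Rightarrow> (real \<Rightarrow> real) \<Rightarrow> bool" where
  "has_bottom_trace a b d u T \<longleftrightarrow>
     in_H1 ({a<..<b} \<times> {0<..<d}) u \<and> in_L2 {a<..<b} T \<and>
     (\<exists>\<phi>. (\<forall>n::nat. smooth_function (\<phi> n)) \<and>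
        (\<lambda>n. H1_norm_sq ({a<..<b} \<times> {0<..<d}) (\<lambda>z. \<phi> n z - u z)) \<longlonglongrightarrow> 0 \<and>
        (\<lambda>n. LINT x:{a<..<b}|lebesgue. (\<phi> n (x, 0) - T x)\<^sup>2) \<longlonglongrightarrow> 0)"

text \<open>\<open>Omega h\<close> need not be Lipschitz (it may have cusps where \<open>h\<close> vanishes), so the trace
  on \<open>y = 0\<close> is taken locally, on all rectangles in \<open>Omega h\<close> standing on \<open>y = 0\<close>.  Their
  bases cover \<open>{h > 0}\<close>, the part of \<open>supp h\<close> that has points of \<open>Omega h\<close> above it; on the
  rest of \<open>supp h\<close> there is no trace.\<close>

definition admissible :: "real \<Rightarrow> ((real \<times> real \<Rightarrow> real) \<times> (real \<Rightarrow> real)) set" where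
  "admissible V = {(u, h).
     in_H1 UNIV h \<and> continuous_on UNIV h \<and> (\<forall>x. 0 \<le> h x) \<and>
     in_H1 (Omega h) u \<and>
     has_bochner_integral lebesgue h V \<and>
     (\<forall>a b d. a < b \<and> 0 < d \<and> {a<..<b} \<times> {0<..<d} \<subseteq> Omega h \<longrightarrow>
        has_bottom_trace a b d u (\<lambda>x. x))}"

definition bulk_energy :: "(real \<times> real \<Rightarrow> real) \<Rightarrow> (real \<Rightarrow> real) \<Rightarrow> real" where
  "bulk_energy u h = dirichlet_energy (Omega h) u"

definition surface_energy :: "(real \<Rightarrow> real) \<Rightarrow> real" where
  "surface_energy h = dirichlet_energy UNIV h"

text \<open>A genuine infimum: the energies are nonnegative, and for \<open>V > 0\<close> the set
  \<open>admissible V\<close> is nonempty (take a bump \<open>h\<close> and \<open>u(x,y) = x\<close>).\<close>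

definition F_s :: "real \<Rightarrow> real" where
  "F_s V = (INF (u, h) \<in> admissible V. bulk_energy u h + surface_energy h)"

end

theory Submission
  imports Defs
begin

text \<open>
  Suppose that \<open>{h > 0}\<close> is the union of two disjoint nonempty open sets \<open>A\<close> and \<open>B\<close>.  Then \<open>h\<close> is the
  sum of the pieces \<open>h1 = 1\<^sub>A h\<close> and \<open>h2 = 1\<^sub>B h\<close>, whose volumes \<open>V1\<close>, \<open>V2\<close> are positive and add up to \<open>V\<close>.
  Each piece, with the same \<open>u\<close>, is admissible for its own volume (\<open>admissible_cut\<close>).  The bulk
  energies \<open>E1\<close>, \<open>E2\<close> of the pieces add up to that of \<open>(u, h)\<close>, and the sum of the surface
  energies \<open>S1\<close>, \<open>S2\<close> is at most that of \<open>h\<close> (\<open>energies_split\<close>).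

  It is cheaper to have one large piece than two small ones.  The dilation that replaces \<open>u\<close> and \<open>h\<close> by
  \<open>c u(\<cdot>/c)\<close> and \<open>c h(\<cdot>/c)\<close> respects the condition \<open>u(x,0) = x\<close> and multiplies the volume
  and the bulk energy by \<open>c\<^sup>2\<close>, but the surface energy only by \<open>c\<close>.  Enlarging the \<open>i\<close>-th piece to the volume
  \<open>V\<close> therefore gives \<open>F_s V < (V / Vi) (Ei + Si)\<close>; the inequality is strict because \<open>Vi < V\<close> and
  \<open>Si > 0\<close> (\<open>F_s_less_scaled_energy\<close>).  Multiplying by \<open>Vi / V\<close> and adding the two inequalities yields
  \<open>F_s V < E1 + S1 + E2 + S2\<close>, and the right side is at most the energy of \<open>(u, h)\<close>, which is
  \<open>F_s V\<close>: a contradiction.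

  Three facts about weak gradients carry this argument.  By the fundamental lemma of the calculus of
  variations they are unique almost everywhere, so an energy may be computed from any weak gradient
  (\<open>dirichlet_energy_eq\<close>).  A smooth function has its classical gradient as weak gradient
  (\<open>is_weak_gradient_smooth\<close>), which is needed to dilate traces.  Finally, \<open>1\<^sub>A h\<close> has the weak derivative
  \<open>1\<^sub>A h'\<close> (\<open>is_weak_gradient_cut\<close>): a continuous function with a weak derivative satisfies the
  fundamental theorem of calculus, and \<open>h\<close> vanishes at the endpoints of the components of \<open>A\<close>.
\<close>

section \<open>Smooth functions and cutoffs\<close>

lemma C_k_SucI:
  assumes "\<And>x. (f has_derivative D x) (at x)" and "\<And>b. b \<in> Basis \<Longrightarrow> C_k k (\<lambda>x. D x b)"
  shows "C_k (Suc k) f"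
proof -
  have "frechet_derivative f (at x) = D x" for x
    using frechet_derivative_at[OF assms(1)[of x]] by simp
  moreover have "f differentiable (at x)" for x
    using assms(1) by (auto simp: differentiable_def)
  ultimately show ?thesis using assms(2) by simp
qed

lemma C_k_Suc_has_derivative:
  "C_k (Suc k) f \<Longrightarrow> (f has_derivative frechet_derivative f (at x)) (at x)"
  by (simp add: frechet_derivative_works)

lemma C_k_SucD: "C_k (Suc k) f \<Longrightarrow> C_k k f"
proof (induction k arbitrary: f)
  case 0
  then show ?case
    by (auto intro!: continuous_at_imp_continuous_on differentiable_imp_continuous_within)
next
  case (Suc k)
  have "C_k k (\<lambda>x. frechet_derivative f (at x) b)" if "b \<in> Basis" for b
    by (rule Suc.IH) (use Suc.prems that in simp)
  then show ?case using Suc.prems by simp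
qed

lemma C_k_continuous: "C_k k f \<Longrightarrow> continuous_on UNIV f"
  by (induction k) (use C_k_SucD in \<open>auto simp del: C_k.simps(2)\<close>)

lemma C_k_const: "C_k k (\<lambda>x. c)"
proof (induction k arbitrary: c)
  case (Suc k)
  then show ?case by (intro C_k_SucI[where D="\<lambda>_ _. 0"]) auto
qed simp

lemma C_k_add: "C_k k f \<Longrightarrow> C_k k g \<Longrightarrow> C_k k (\<lambda>x. f x + g x)"
proof (induction k arbitrary: f g)
  case (Suc k)
  note f = C_k_Suc_has_derivative[OF Suc.prems(1)] and g = C_k_Suc_has_derivative[OF Suc.prems(2)]
  show ?case
    by (rule C_k_SucI[OF has_derivative_add[OF f g]]) (use Suc in auto)
qed (simp add: continuous_on_add)

lemma C_k_mult: "C_k k f \<Longrightarrow> C_k k g \<Longrightarrow> C_k k (\<lambda>x. f x * g x)"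
proof (induction k arbitrary: f g)
  case (Suc k)
  note f = C_k_Suc_has_derivative[OF Suc.prems(1)] and g = C_k_Suc_has_derivative[OF Suc.prems(2)]
  note f' = C_k_SucD[OF Suc.prems(1)] and g' = C_k_SucD[OF Suc.prems(2)]
  show ?case
    by (rule C_k_SucI[OF has_derivative_mult[OF f g]])
      (use Suc f' g' in \<open>auto intro!: C_k_add Suc.IH\<close>)
qed (simp add: continuous_on_mult)

lemma C_k_cmult: "C_k k f \<Longrightarrow> C_k k (\<lambda>x. c * f x)"
  by (intro C_k_mult C_k_const)

lemma C_k_diff: "C_k k f \<Longrightarrow> C_k k g \<Longrightarrow> C_k k (\<lambda>x. f x - g x)"
  using C_k_add[of k f "\<lambda>x. (-1) * g x"] C_k_cmult[of k g "-1"] by simp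

lemma C_k_prod: "finite I \<Longrightarrow> (\<And>i. i \<in> I \<Longrightarrow> C_k k (f i)) \<Longrightarrow> C_k k (\<lambda>x. \<Prod>i\<in>I. f i x)"
  by (induction I rule: finite_induct) (auto intro!: C_k_const C_k_mult)

lemma C_k_dilation: "C_k k f \<Longrightarrow> C_k k (\<lambda>x. f (c *\<^sub>R x))"
proof (induction k arbitrary: f)
  case 0
  then show ?case
    by (auto intro!: continuous_intros intro: continuous_on_compose2)
next
  case (Suc k)
  note f = C_k_Suc_has_derivative[OF Suc.prems]
  have lin: "linear (frechet_derivative f (at x))" for x
    using f has_derivative_linear by blast
  have "((\<lambda>x. f (c *\<^sub>R x)) has_derivative (\<lambda>y. frechet_derivative f (at (c *\<^sub>R x)) (c *\<^sub>R y))) (at x)" for x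
    using has_derivative_compose[OF has_derivative_scaleR_right[OF has_derivative_ident] f] .
  then show ?case
    by (rule C_k_SucI) (use Suc lin in \<open>auto simp: linear_scale intro!: C_k_cmult\<close>)
qed

lemma frechet_derivative_dilation:
  assumes "\<And>x. f differentiable (at x)"
  shows "frechet_derivative (\<lambda>x. f (c *\<^sub>R x)) (at x) b = c * frechet_derivative f (at (c *\<^sub>R x)) b"
proof -
  have f: "(f has_derivative frechet_derivative f (at x)) (at x)" for x
    using assms by (simp add: frechet_derivative_works)
  have "((\<lambda>x. f (c *\<^sub>R x)) has_derivative (\<lambda>y. frechet_derivative f (at (c *\<^sub>R x)) (c *\<^sub>R y))) (at x)"
    using has_derivative_compose[OF has_derivative_scaleR_right[OF has_derivative_ident] f] .
  from frechet_derivative_at[OF this, symmetric] show ?thesis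
    using linear_scale[OF has_derivative_linear[OF f]] by simp
qed

text \<open>The cutoffs below are built from one-variable profiles; this transports their smoothness to
  functions of one coordinate in any dimension and, for \<open>'a = real\<close>, to rescaled profiles on
  the line.\<close>
lemma C_k_ridge:
  fixes f :: "real \<Rightarrow> real" and v :: "'a::euclidean_space"
  shows "C_k k f \<Longrightarrow> C_k k (\<lambda>x. f (x \<bullet> v + d))"
proof (induction k arbitrary: f)
  case 0
  then show ?case
    by (auto intro!: continuous_intros intro: continuous_on_compose2)
next
  case (Suc k)
  note f = C_k_Suc_has_derivative[OF Suc.prems]
  have lin: "linear (frechet_derivative f (at x))" for x
    using f has_derivative_linear by blast
  have eq: "frechet_derivative f (at x) y = y * frechet_derivative f (at x) 1" for x y
    using linear_scale[OF lin, of x y 1] by simp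
  have "((\<lambda>x. x \<bullet> v + d) has_derivative (\<lambda>y. y \<bullet> v)) (at x)" for x
    by (auto intro!: derivative_eq_intros)
  then have "((\<lambda>x. f (x \<bullet> v + d)) has_derivative
      (\<lambda>y. frechet_derivative f (at (x \<bullet> v + d)) (y \<bullet> v))) (at x)" for x
    by (rule has_derivative_compose[OF _ f])
  then have "((\<lambda>x. f (x \<bullet> v + d)) has_derivative
      (\<lambda>y. (y \<bullet> v) * frechet_derivative f (at (x \<bullet> v + d)) 1)) (at x)" for x
    by (subst (asm) eq)
  then show ?case
    by (rule C_k_SucI) (use Suc in \<open>auto intro!: C_k_cmult\<close>)
qed

lemma C_k_real_SucI:
  fixes f :: "real \<Rightarrow> real"
  assumes "\<And>x. (f has_real_derivative f' x) (at x)" and "C_k k f'"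
  shows "C_k (Suc k) f"
  by (rule C_k_SucI[where D="\<lambda>x y. f' x * y"])
    (use assms in \<open>auto simp: has_field_derivative_def\<close>)

text \<open>The standard function that is smooth but not analytic at \<open>0\<close> is \<open>flat 0\<close>.  The powers of
  \<open>1 / x\<close> are included because the family is closed under differentiation up to linear
  combinations, so that smoothness of all members follows by one induction.\<close>
definition flat :: "nat \<Rightarrow> real \<Rightarrow> real" where
  "flat m x = (if x \<le> 0 then 0 else (1 / x) ^ m * exp (- (1 / x)))"

lemma flat_tendsto_0: "(flat m \<longlongrightarrow> 0) (at 0)"
proof -
  have "((\<lambda>x. (1/x) ^ m / exp (1/x)) \<longlongrightarrow> (0::real)) (at_right 0)"
    by (rule filterlim_compose[OF tendsto_power_div_exp_0])
      (simp add: filterlim_inverse_at_top_right flip: inverse_eq_divide)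
  then have "(flat m \<longlongrightarrow> 0) (at_right 0)"
    by (rule Lim_transform_eventually)
      (auto simp: eventually_at_filter flat_def exp_minus field_simps)
  moreover have "(flat m \<longlongrightarrow> 0) (at_left 0)"
    by (rule Lim_transform_eventually[OF tendsto_const])
      (auto simp: eventually_at_filter flat_def)
  ultimately show ?thesis by (simp add: filterlim_split_at)
qed

text \<open>At \<open>0\<close> the difference quotient of \<open>flat m\<close> is \<open>flat (m + 1)\<close> itself, which tends to \<open>0\<close>
  because the exponential beats every power.\<close>
lemma flat_has_derivative:
  "(flat m has_real_derivative flat (m + 2) x - of_nat m * flat (m + 1) x) (at x)"
proof -
  consider "x < 0" | "x = 0" | "x > 0" by linarith
  then show ?thesis
  proof cases
    case 1
    have "((\<lambda>_. 0) has_real_derivative 0) (at x)" by simp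
    then have "(flat m has_real_derivative 0) (at x)"
      by (rule has_field_derivative_transform_within_open[of _ _ _ "{..<0}"])
        (use 1 in \<open>auto simp: flat_def\<close>)
    then show ?thesis using 1 by (simp add: flat_def)
  next
    case 2
    have "(\<lambda>h. (flat m (0 + h) - flat m 0) / h) = flat (m + 1)"
      by (auto simp: flat_def fun_eq_iff)
    then have "(flat m has_real_derivative 0) (at 0)"
      unfolding DERIV_def using flat_tendsto_0[of "m + 1"] by simp
    then show ?thesis using 2 by (simp add: flat_def)
  next
    case 3
    have power_exp: "((\<lambda>x. r x ^ m * exp (- r x)) has_real_derivative
        r x ^ (m + 2) * exp (- r x) - of_nat m * (r x ^ (m + 1) * exp (- r x))) (at x)"
      if "(r has_real_derivative - ((r x)\<^sup>2)) (at x)" for r :: "real \<Rightarrow> real"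
    proof (cases m)
      case 0
      then show ?thesis
        using that by (auto intro!: derivative_eq_intros simp: algebra_simps power2_eq_square)
    next
      case (Suc k)
      have "((\<lambda>x. exp (- r x)) has_real_derivative exp (- r x) * (r x)\<^sup>2) (at x)"
        using that by (auto intro!: derivative_eq_intros)
      from DERIV_mult[OF DERIV_power_Suc[OF that, of k] this] show ?thesis
        unfolding Suc by (rule DERIV_cong) (simp add: Suc algebra_simps power2_eq_square)
    qed
    have "((\<lambda>x. 1 / x) has_real_derivative - ((1 / x)\<^sup>2)) (at x)"
      using 3 by (auto intro!: derivative_eq_intros simp: power2_eq_square)
    note power_exp[OF this]
    then have "(flat m has_real_derivative
       (1 / x) ^ (m + 2) * exp (- (1 / x)) - of_nat m * ((1 / x) ^ (m + 1) * exp (- (1 / x)))) (at x)"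
      by (rule has_field_derivative_transform_within_open[of _ _ _ "{0<..}"])
        (use 3 in \<open>auto simp: flat_def\<close>)
    then show ?thesis using 3 by (simp add: flat_def)
  qed
qed

lemma C_k_flat: "C_k k (flat m)"
proof (induction k arbitrary: m)
  case 0
  then show ?case
    using flat_has_derivative by (auto intro!: continuous_at_imp_continuous_on DERIV_isCont)
next
  case (Suc k)
  then show ?case
    by (intro C_k_real_SucI[OF flat_has_derivative] C_k_diff C_k_cmult)
qed

lemma flat_0_bounds: "0 \<le> flat 0 x" "flat 0 x \<le> 1" "flat 0 x > 0 \<longleftrightarrow> x > 0" "flat 0 x = 0 \<longleftrightarrow> x \<le> 0"
  by (auto simp: flat_def)

text \<open>As \<open>n\<close> grows, these functions increase to the indicator of the open box: each factor tends
  to \<open>1\<close> at a positive argument and is \<open>0\<close> at the others.\<close>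
definition box_bump :: "'a::euclidean_space \<Rightarrow> 'a \<Rightarrow> nat \<Rightarrow> 'a \<Rightarrow> real" where
  "box_bump a b n x =
     (\<Prod>i\<in>Basis. flat 0 (real n * (x \<bullet> i - a \<bullet> i)) * flat 0 (real n * (b \<bullet> i - x \<bullet> i)))"

lemma smooth_box_bump: "smooth_function (box_bump a b n)"
proof -
  have *: "flat 0 (real n * (x \<bullet> i - a \<bullet> i)) = flat 0 (x \<bullet> (real n *\<^sub>R i) + - (real n * (a \<bullet> i)))"
     "flat 0 (real n * (b \<bullet> i - x \<bullet> i)) = flat 0 (x \<bullet> ((- real n) *\<^sub>R i) + real n * (b \<bullet> i))" for x i
    by (simp_all add: algebra_simps)
  show ?thesis
    unfolding smooth_function_def box_bump_def *
    by (intro allI C_k_prod C_k_mult C_k_ridge C_k_flat finite_Basis)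
qed

lemma box_bump_bounds: "0 \<le> box_bump a b n x" "box_bump a b n x \<le> 1"
  unfolding box_bump_def
  by (auto intro!: prod_nonneg prod_le_1 mult_nonneg_nonneg mult_le_one flat_0_bounds)

lemma box_bump_eq_0: "x \<notin> box a b \<Longrightarrow> box_bump a b n x = 0"
  unfolding box_bump_def mem_box
  by (auto simp: flat_0_bounds not_less mult_nonneg_nonpos intro!: bexI)

lemma box_bump_tendsto: "(\<lambda>n. box_bump a b n x) \<longlonglongrightarrow> indicator (box a b) x"
proof (cases "x \<in> box a b")
  case True
  have *: "(\<lambda>n. flat 0 (real n * c)) \<longlonglongrightarrow> 1" if "c > 0" for c
  proof -
    have "filterlim (\<lambda>n. real n * c) at_top sequentially"
      using that by (intro filterlim_at_top_mult_tendsto_pos[OF tendsto_const] filterlim_real_sequentially)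
    then have "(\<lambda>n. exp (- (1 / (real n * c)))) \<longlonglongrightarrow> exp (- 0)"
      by (intro tendsto_intros) (auto intro!: real_tendsto_divide_at_top tendsto_const)
    then have "(\<lambda>n. exp (- (1 / (real n * c)))) \<longlonglongrightarrow> 1" by simp
    then show ?thesis
      by (rule Lim_transform_eventually)
       (use that in \<open>auto simp: flat_def mult_le_0_iff intro!: eventually_sequentiallyI[of 1]\<close>)
  qed
  have "(\<lambda>n. box_bump a b n x) \<longlonglongrightarrow> (\<Prod>i\<in>(Basis::'a set). 1 * 1)"
    unfolding box_bump_def
    by (intro tendsto_prod tendsto_mult *) (use True in \<open>auto simp: mem_box\<close>)
  then show ?thesis using True by simp
qed (simp add: box_bump_eq_0)

lemma test_functionI:
  assumes "smooth_function \<phi>" "compact K" "K \<subseteq> \<Omega>" "\<And>x. x \<notin> K \<Longrightarrow> \<phi> x = 0"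
  shows "test_function \<Omega> \<phi>"
proof -
  have "closure {x. \<phi> x \<noteq> 0} \<subseteq> K"
    by (rule closure_minimal) (use assms compact_imp_closed in auto)
  then show ?thesis
    using assms compact_Int_closed[OF assms(2) closed_closure[of "{x. \<phi> x \<noteq> 0}"]]
    by (auto simp: test_function_def Int_absorb1)
qed

lemma test_function_box_bump: "cbox a b \<subseteq> \<Omega> \<Longrightarrow> test_function \<Omega> (box_bump a b n)"
  by (rule test_functionI[OF smooth_box_bump compact_cbox[of a b]])
    (auto intro: box_bump_eq_0 simp: box_subset_cbox[THEN subsetD])

text \<open>The derivative \<open>\<theta>'\<close> of the step is a bump of mass \<open>1\<close>; rescaled, it serves as an
  approximate identity.\<close>
lemma smooth_step_exists:
  obtains \<theta> \<theta>' :: "real \<Rightarrow> real"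
  where "\<And>k. C_k k \<theta>" "continuous_on UNIV \<theta>'" "\<And>x. (\<theta> has_real_derivative \<theta>' x) (at x)"
    "\<And>x. x \<le> 0 \<Longrightarrow> \<theta> x = 0" "\<And>x. x \<ge> 1 \<Longrightarrow> \<theta> x = 1" "\<And>x. 0 \<le> \<theta> x" "\<And>x. \<theta> x \<le> 1"
    "\<And>x. x \<notin> {0..1} \<Longrightarrow> \<theta>' x = 0"
proof -
  define \<psi> where "\<psi> x = flat 0 x * flat 0 (x \<bullet> (-1) + 1)" for x
  have C: "C_k k \<psi>" for k
    unfolding \<psi>_def[abs_def] by (intro C_k_mult C_k_flat C_k_ridge)
  have cont: "continuous_on UNIV \<psi>" using C by (rule C_k_continuous)
  have pos: "\<psi> x \<ge> 0" for x by (simp add: \<psi>_def flat_0_bounds)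
  have pos': "\<psi> x > 0" if "0 < x" "x < 1" for x
    unfolding \<psi>_def by (rule mult_pos_pos) (use that in \<open>auto simp: flat_0_bounds\<close>)
  have zero: "\<psi> x = 0" if "x \<notin> {0<..<1}" for x
    using that by (auto simp: \<psi>_def flat_0_bounds)
  \<comment> \<open>The step is the normalized antiderivative of a bump on the unit interval.\<close>
  obtain F where "\<And>x. (F has_vector_derivative \<psi> x) (at x)"
    using einterval_antiderivative[of "-\<infinity>" "\<infinity>" \<psi>] cont
    by (auto simp: continuous_on_eq_continuous_at)
  then have F: "(F has_real_derivative \<psi> x) (at x)" for x
    by (simp add: has_real_derivative_iff_has_vector_derivative)
  have mono: "F x \<le> F y" if "x \<le> y" for x y
    by (rule DERIV_nonneg_imp_nondecreasing[OF that]) (use F pos in blast)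
  have lt: "F 0 < F 1"
    by (rule DERIV_pos_imp_increasing_open[of 0 1 F])
      (use F pos' in \<open>auto intro!: continuous_at_imp_continuous_on DERIV_isCont\<close>)
  have left: "F x = F 0" if "x \<le> 0" for x
  proof (cases "x = 0")
    case False
    then show ?thesis
      using that DERIV_isconst_end[of x 0 F] F zero
      by (metis DERIV_isCont DERIV_isconst2 continuous_at_imp_continuous_on greaterThanLessThan_iff
          less_eq_real_def order_less_irrefl order_less_trans)
  qed simp
  have right: "F x = F 1" if "x \<ge> 1" for x
  proof (cases "x = 1")
    case False
    then show ?thesis
      using that DERIV_isconst_end[of 1 x F] F zero
      by (metis DERIV_isCont continuous_at_imp_continuous_on greaterThanLessThan_iff
          less_eq_real_def order_less_irrefl order_less_trans)
  qed simp
  define \<theta> where "\<theta> x = (1 / (F 1 - F 0)) * (F x - F 0)" for x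
  define \<theta>' where "\<theta>' x = (1 / (F 1 - F 0)) * \<psi> x" for x
  have D: "(\<theta> has_real_derivative \<theta>' x) (at x)" for x
    using DERIV_cmult[OF DERIV_diff[OF F DERIV_const[of "F 0"]], of "1 / (F 1 - F 0)" x]
    by (simp add: \<theta>_def[abs_def] \<theta>'_def)
  have "C_k (Suc k) \<theta>" for k
    by (rule C_k_real_SucI[OF D]) (auto simp: \<theta>'_def[abs_def] intro!: C_k_cmult[of _ _ "1 / (F 1 - F 0)", simplified] C)
  then have 1: "C_k k \<theta>" for k by (rule C_k_SucD)
  have 2: "continuous_on UNIV \<theta>'" unfolding \<theta>'_def[abs_def] by (intro continuous_intros cont)
  have 3: "0 \<le> \<theta> x" "\<theta> x \<le> 1" for x
    using lt left[of x] right[of x] mono[of 0 x] mono[of x 1]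
    by (auto simp: \<theta>_def field_simps) (smt (verit))+
  have 4: "\<theta> x = 0" if "x \<le> 0" for x
    using left[OF that] by (simp add: \<theta>_def)
  have 5: "\<theta> x = 1" if "x \<ge> 1" for x
    using right[OF that] less_imp_neq[OF lt] by (auto simp: \<theta>_def)
  have 6: "\<theta>' x = 0" if "x \<notin> {0..1}" for x
    using that zero[of x] by (cases "x \<le> 0") (auto simp: \<theta>'_def)
  show ?thesis by (rule that[OF 1 2 D 4 5 3 6])
qed

section \<open>Uniqueness of weak gradients\<close>

text \<open>The Borel sets over which \<open>F\<close> has integral \<open>0\<close> form a Dynkin system that contains the
  intersection-stable generator of all open boxes.\<close>
lemma AE_zero_if_box_integrals_zero:
  fixes F :: "'a::euclidean_space \<Rightarrow> real"
  assumes F: "integrable lborel F" and total: "integral\<^sup>L lborel F = 0"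
    and box: "\<And>a b. (LINT x:box a b|lborel. F x) = 0"
  shows "AE x in lborel. F x = 0"
proof (rule sigma_finite_measure.density_zero[OF sigma_finite_lborel F])
  fix A :: "'a set" assume "A \<in> sets lborel"
  then have A: "A \<in> sigma_sets UNIV (range (\<lambda>(a, b). box a b))"
    using borel_eq_box by (metis sets_lborel sets_measure_of subset_UNIV Pow_UNIV)
  have int: "set_integrable lborel B F" if "B \<in> sets lborel" for B
    unfolding set_integrable_def by (rule integrable_mult_indicator[OF that F])
  have meas: "B \<in> sets lborel" if "B \<in> sigma_sets UNIV (range (\<lambda>(a, b). box a b))" for B :: "'a set"
    using that borel_eq_box by (metis sets_lborel sets_measure_of subset_UNIV Pow_UNIV)
  show "(LINT x:A|lborel. F x) = 0"
  proof (rule sigma_sets_induct_disjoint[OF _ _ A])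
    show "Int_stable (range (\<lambda>(a, b). box a b :: 'a set))"
      by (auto simp: Int_stable_def box_Int_box)
    show "(LINT x:B|lborel. F x) = 0" if "B \<in> range (\<lambda>(a, b). box a b)" for B
      using that box by auto
  next
    fix B :: "'a set" assume B: "B \<in> sigma_sets UNIV (range (\<lambda>(a, b). box a b))"
      and IH: "(LINT x:B|lborel. F x) = 0"
    have "(LINT x:(UNIV - B) \<union> B|lborel. F x) = (LINT x:UNIV - B|lborel. F x) + (LINT x:B|lborel. F x)"
      by (rule set_integral_Un) (use meas[OF B] in \<open>auto intro!: int\<close>)
    then show "(LINT x:UNIV - B|lborel. F x) = 0"
      using IH total by (simp add: set_lebesgue_integral_def)
  next
    fix B :: "nat \<Rightarrow> 'a set"
    assume "disjoint_family B" and B: "range B \<subseteq> sigma_sets UNIV (range (\<lambda>(a, b). box a b))"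
      and IH: "\<And>i. (LINT x:B i|lborel. F x) = 0"
    have Bi: "B i \<in> sets lborel" for i by (rule meas) (use B in auto)
    have "(LINT x:(\<Union>i. B i)|lborel. F x) = (\<Sum>i. (LINT x:B i|lborel. F x))"
      by (rule lebesgue_integral_countable_add)
        (use Bi \<open>disjoint_family B\<close> in \<open>auto simp: disjoint_family_on_def intro!: int\<close>)
    then show "(LINT x:(\<Union>i. B i)|lborel. F x) = 0" using IH by simp
  qed (auto simp: set_lebesgue_integral_def)
qed

lemma continuous_borel_measurable_lebesgue:
  fixes f :: "'a::euclidean_space \<Rightarrow> 'b::euclidean_space"
  shows "continuous_on UNIV f \<Longrightarrow> f \<in> borel_measurable lebesgue"
  by (intro measurable_completion) (simp add: borel_measurable_continuous_onI)

lemma set_integrable_mult_compact_support: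
  fixes f \<psi> :: "'a::euclidean_space \<Rightarrow> real"
  assumes f: "locally_integrable \<Omega> f" and \<psi>: "continuous_on UNIV \<psi>"
    and K: "compact K" "K \<subseteq> \<Omega>" and zero: "\<And>x. x \<notin> K \<Longrightarrow> \<psi> x = 0"
  shows "set_integrable lebesgue \<Omega> (\<lambda>x. f x * \<psi> x)"
proof -
  have fK: "integrable lebesgue (\<lambda>x. indicator K x * f x)"
    using f K by (auto simp: locally_integrable_def set_integrable_def)
  have "compact (\<psi> ` K)"
    using K \<psi> by (meson compact_continuous_image continuous_on_subset subset_UNIV)
  then obtain M where M: "\<And>x. x \<in> K \<Longrightarrow> \<bar>\<psi> x\<bar> \<le> M"
    by (metis compact_imp_bounded bounded_iff imageI real_norm_def)
  have eq: "indicator \<Omega> x *\<^sub>R (f x * \<psi> x) = indicator K x * f x * \<psi> x" for x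
    using zero[of x] K by (auto simp: indicator_def)
  have "integrable lebesgue (\<lambda>x. indicator K x * f x * \<psi> x)"
  proof (rule Bochner_Integration.integrable_bound)
    show "integrable lebesgue (\<lambda>x. M * (indicator K x * f x))" using fK by simp
    show "(\<lambda>x. indicator K x * f x * \<psi> x) \<in> borel_measurable lebesgue"
      by (intro borel_measurable_times borel_measurable_integrable[OF fK]
          continuous_borel_measurable_lebesgue \<psi>)
    have "\<bar>f x * \<psi> x\<bar> \<le> \<bar>M * f x\<bar>" if "x \<in> K" for x
      using M[OF that] by (simp add: abs_mult mult.commute mult_right_mono)
    then show "AE x in lebesgue. norm (indicator K x * f x * \<psi> x) \<le> norm (M * (indicator K x * f x))"
      by (auto simp: indicator_def)
  qed
  then show ?thesis by (simp only: set_integrable_def eq)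
qed

text \<open>Dominated convergence along the bumps that increase to the indicator of the box.\<close>
lemma integral_box_if_test_integrals_zero:
  fixes f :: "'a::euclidean_space \<Rightarrow> real"
  assumes f: "locally_integrable \<Omega> f"
    and zero: "\<And>\<phi>. test_function \<Omega> \<phi> \<Longrightarrow> (LINT x:\<Omega>|lebesgue. f x * \<phi> x) = 0"
    and ab: "cbox a b \<subseteq> \<Omega>"
  shows "(LINT x:box a b|lebesgue. f x) = 0"
proof -
  have fK: "integrable lebesgue (\<lambda>x. indicator (cbox a b) x * f x)"
    using f ab by (auto simp: locally_integrable_def set_integrable_def)
  have fB: "integrable lebesgue (\<lambda>x. indicator (box a b) x * f x)"
  proof -
    have "integrable lebesgue (\<lambda>x. indicator (box a b) x *\<^sub>R (indicator (cbox a b) x * f x))"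
      by (rule integrable_mult_indicator) (use fK in auto)
    moreover have "indicator (box a b) x *\<^sub>R (indicator (cbox a b) x * f x) = indicator (box a b) x * f x" for x
      using box_subset_cbox[of a b] by (auto simp: indicator_def)
    ultimately show ?thesis by (simp only:)
  qed
  have "(\<lambda>n. LINT x|lebesgue. indicator (box a b) x * f x * box_bump a b n x)
      \<longlonglongrightarrow> (LINT x|lebesgue. indicator (box a b) x * f x)"
  proof (rule integral_dominated_convergence)
    show "(\<lambda>x. indicator (box a b) x * f x) \<in> borel_measurable lebesgue"
      by (rule borel_measurable_integrable[OF fB])
    show "(\<lambda>x. indicator (box a b) x * f x * box_bump a b n x) \<in> borel_measurable lebesgue" for n
      using smooth_box_bump[of a b n] unfolding smooth_function_def
      by (intro borel_measurable_times borel_measurable_integrable[OF fB]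
          continuous_borel_measurable_lebesgue) (auto dest: C_k_continuous)
    show "integrable lebesgue (\<lambda>x. \<bar>indicator (box a b) x * f x\<bar>)" using fB by simp
    have "(\<lambda>n. indicator (box a b) x * f x * box_bump a b n x) \<longlonglongrightarrow> indicator (box a b) x * f x * indicator (box a b) x" for x
      by (intro tendsto_intros box_bump_tendsto)
    moreover have "indicator (box a b) x * f x * indicator (box a b) x = indicator (box a b) x * f x" for x
      by (simp add: indicator_def)
    ultimately show "AE x in lebesgue. (\<lambda>n. indicator (box a b) x * f x * box_bump a b n x) \<longlonglongrightarrow> indicator (box a b) x * f x"
      by (intro AE_I2) metis
    have "\<bar>indicator (box a b) x * f x * box_bump a b n x\<bar> \<le> \<bar>indicator (box a b) x * f x\<bar> * 1" for n x
      unfolding abs_mult[of "indicator (box a b) x * f x"]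
      using box_bump_bounds[of a b n x] by (intro mult_left_mono) auto
    then show "AE x in lebesgue. norm (indicator (box a b) x * f x * box_bump a b n x) \<le> \<bar>indicator (box a b) x * f x\<bar>" for n
      by simp
  qed
  moreover have "indicator (box a b) x * f x * box_bump a b n x = indicator \<Omega> x *\<^sub>R (f x * box_bump a b n x)" for n x
    using ab box_subset_cbox[of a b] box_bump_eq_0[of x a b n] by (auto simp: indicator_def)
  moreover have "(LINT x|lebesgue. indicator \<Omega> x *\<^sub>R (f x * box_bump a b n x)) = 0" for n
    using zero[OF test_function_box_bump[OF ab]] by (simp add: set_lebesgue_integral_def)
  ultimately show ?thesis
    by (simp add: set_lebesgue_integral_def LIMSEQ_const_iff)
qed

text \<open>All integrals of \<open>f\<close> over boxes compactly contained in \<open>\<Omega>\<close> vanish, hence \<open>f\<close> vanishes almost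
  everywhere in each of countably many closed boxes that exhaust \<open>\<Omega>\<close>.\<close>
lemma fundamental_lemma_calculus_of_variations:
  fixes f :: "'a::euclidean_space \<Rightarrow> real"
  assumes "open \<Omega>" and f: "locally_integrable \<Omega> f"
    and zero: "\<And>\<phi>. test_function \<Omega> \<phi> \<Longrightarrow> (LINT x:\<Omega>|lebesgue. f x * \<phi> x) = 0"
  shows "AE x in lebesgue. x \<in> \<Omega> \<longrightarrow> f x = 0"
proof -
  have box0: "(LINT x:box a b|lebesgue. f x) = 0" if "cbox a b \<subseteq> \<Omega>" for a b
    by (rule integral_box_if_test_integrals_zero[OF f zero that])
  have cb: "AE x in lebesgue. x \<in> cbox c d \<longrightarrow> f x = 0" if cd: "cbox c d \<subseteq> \<Omega>" for c d
  proof -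
    define F where "F x = indicator (box c d) x * f x" for x
    have "set_integrable lebesgue (cbox c d) f"
      using f cd by (auto simp: locally_integrable_def)
    then have "set_integrable lebesgue (box c d) f"
      by (rule set_integrable_subset) (auto simp: box_subset_cbox)
    then have F: "integrable lebesgue F" by (simp add: set_integrable_def F_def[abs_def])
    \<comment> \<open>The Dynkin argument concerns Borel sets, so \<open>F\<close> is replaced by a Borel version.\<close>
    obtain G where G[measurable]: "G \<in> borel_measurable lborel" and "AE x in lborel. F x = G x"
      using completion_ex_borel_measurable_real[OF borel_measurable_integrable[OF F]] by blast
    then have FG: "AE x in lebesgue. F x = G x" by (intro AE_completion)
    have Gl[measurable]: "G \<in> borel_measurable lebesgue" by (rule measurable_completion[OF G])
    have Fl[measurable]: "F \<in> borel_measurable lebesgue" by (rule borel_measurable_integrable[OF F])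
    have "integrable lebesgue G" using F integrable_cong_AE[OF Fl Gl FG] by simp
    then have Gint: "integrable lborel G" by (simp add: integrable_completion)
    have boxG: "(LINT x:box a b|lborel. G x) = 0" for a b
    proof -
      have "(LINT x:box a b|lborel. G x) = (LINT x:box a b|lebesgue. G x)"
        unfolding set_lebesgue_integral_def by (subst integral_completion) auto
      also have "\<dots> = (LINT x:box a b|lebesgue. F x)"
        unfolding set_lebesgue_integral_def
      proof (rule integral_cong_AE)
        show "AE x in lebesgue. indicator (box a b) x *\<^sub>R G x = indicator (box a b) x *\<^sub>R F x"
          using FG by eventually_elim simp
      qed (auto intro!: borel_measurable_times borel_measurable_indicator Gl Fl)
      also have "\<dots> = (LINT x:box a b \<inter> box c d|lebesgue. f x)"
        unfolding set_lebesgue_integral_def F_def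
        by (intro Bochner_Integration.integral_cong) (auto simp: indicator_def)
      also have "\<dots> = 0"
      proof (cases "box a b \<inter> box c d = {}")
        case False
        define p q where "p = (\<Sum>i\<in>Basis. max (a \<bullet> i) (c \<bullet> i) *\<^sub>R i)" and "q = (\<Sum>i\<in>Basis. min (b \<bullet> i) (d \<bullet> i) *\<^sub>R i)"
        have pq: "box a b \<inter> box c d = box p q" by (simp add: box_Int_box p_def q_def)
        have "closure (box p q) \<subseteq> closure (box c d)" using pq by (metis Int_lower2 closure_mono)
        then have "cbox p q \<subseteq> cbox c d"
          using False pq by (metis closure_box Int_empty_right)
        then show ?thesis unfolding pq using cd by (intro box0) auto
      qed (simp add: set_lebesgue_integral_def)
      finally show ?thesis .
    qed
    have "integral\<^sup>L lborel G = integral\<^sup>L lebesgue G" by (simp add: integral_completion)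
    also have "\<dots> = integral\<^sup>L lebesgue F" by (rule integral_cong_AE[OF Gl Fl]) (use FG in \<open>eventually_elim, simp\<close>)
    also have "\<dots> = 0" using box0[OF cd] by (simp add: F_def[abs_def] set_lebesgue_integral_def)
    finally have "AE x in lborel. G x = 0"
      by (intro AE_zero_if_box_integrals_zero Gint boxG)
    then have "AE x in lebesgue. G x = 0" by (rule AE_completion)
    moreover have "AE x in lebesgue. x \<notin> cbox c d - box c d"
      by (rule AE_not_in) (simp add: negligible_frontier_interval flip: negligible_iff_null_sets)
    ultimately show ?thesis
      using FG by eventually_elim (auto simp: F_def indicator_def)
  qed
  obtain D where D: "countable D" "D \<subseteq> Pow \<Omega>" "\<And>X. X \<in> D \<Longrightarrow> \<exists>a b. X = cbox a b" "\<Union>D = \<Omega>"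
    by (rule open_countable_Union_open_cbox[OF \<open>open \<Omega>\<close>]) blast
  have "AE x in lebesgue. \<forall>X\<in>D. x \<in> X \<longrightarrow> f x = 0"
    using D cb by (subst AE_ball_countable) (auto, blast)
  then show ?thesis by eventually_elim (use D(4) in blast)
qed

text \<open>An open set is a countable union of compact boxes, so the restriction of \<open>f\<close> to it is a pointwise
  limit of restrictions to compact sets.\<close>
lemma locally_integrable_measurable:
  fixes f :: "'a::euclidean_space \<Rightarrow> 'b::euclidean_space"
  assumes "open \<Omega>" and f: "locally_integrable \<Omega> f"
  shows "set_borel_measurable lebesgue \<Omega> f"
proof (cases "\<Omega> = {}")
  case False
  obtain D where D: "countable D" "D \<subseteq> Pow \<Omega>" "\<And>X. X \<in> D \<Longrightarrow> \<exists>a b. X = cbox a b" "\<Union>D = \<Omega>"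
    by (rule open_countable_Union_open_cbox[OF \<open>open \<Omega>\<close>]) blast
  have "D \<noteq> {}" using D(4) False by auto
  define K where "K n = (\<Union>i\<le>n. from_nat_into D i)" for n :: nat
  have inD: "from_nat_into D i \<in> D" for i by (rule from_nat_into[OF \<open>D \<noteq> {}\<close>])
  have "compact (from_nat_into D i)" for i using D(3)[OF inD[of i]] by auto
  then have "compact (K n)" for n unfolding K_def by (intro compact_UN) auto
  moreover have "K n \<subseteq> \<Omega>" for n using inD D(2) by (fastforce simp: K_def)
  ultimately have m: "(\<lambda>x. indicator (K n) x *\<^sub>R f x) \<in> borel_measurable lebesgue" for n
    using f[unfolded locally_integrable_def set_integrable_def, rule_format, of "K n"]
    by (simp add: borel_measurable_integrable)
  show ?thesis
    unfolding set_borel_measurable_def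
  proof (rule borel_measurable_LIMSEQ_metric[OF m])
    fix x
    show "(\<lambda>n. indicator (K n) x *\<^sub>R f x) \<longlonglongrightarrow> indicator \<Omega> x *\<^sub>R f x"
    proof (cases "x \<in> \<Omega>")
      case True
      then obtain X where "X \<in> D" "x \<in> X" using D(4) by auto
      then obtain i where "x \<in> from_nat_into D i" using from_nat_into_surj[OF D(1)] by metis
      then have "\<forall>\<^sub>F n in sequentially. indicator \<Omega> x *\<^sub>R f x = indicator (K n) x *\<^sub>R f x"
        by (intro eventually_sequentiallyI[of i]) (use True in \<open>auto simp: K_def indicator_def\<close>)
      then show ?thesis by (rule Lim_transform_eventually[OF tendsto_const])
    next
      case False
      then have "x \<notin> K n" for n using \<open>\<And>n. K n \<subseteq> \<Omega>\<close> by auto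
      then show ?thesis using False by simp
    qed
  qed
qed (simp add: set_borel_measurable_def)

lemma locally_integrable_inner:
  assumes "locally_integrable \<Omega> g"
  shows "locally_integrable \<Omega> (\<lambda>x. g x \<bullet> b)"
  unfolding locally_integrable_def set_integrable_def
proof (intro allI impI)
  fix K assume "K \<subseteq> \<Omega>" "compact K"
  then have "integrable lebesgue (\<lambda>x. indicator K x *\<^sub>R g x)"
    using assms by (simp add: locally_integrable_def set_integrable_def)
  from integrable_inner_left[OF this, of b]
  show "integrable lebesgue (\<lambda>x. indicator K x *\<^sub>R (g x \<bullet> b))"
    by (simp only: inner_scaleR_left real_scaleR_def)
qed

lemma locally_integrable_diff:
  "locally_integrable \<Omega> f \<Longrightarrow> locally_integrable \<Omega> g \<Longrightarrow> locally_integrable \<Omega> (\<lambda>x. f x - g x)"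
  unfolding locally_integrable_def by (blast intro: set_integral_diff(1))

lemma locally_integrable_continuous:
  fixes f :: "'a::euclidean_space \<Rightarrow> 'b::euclidean_space"
  assumes "continuous_on UNIV f"
  shows "locally_integrable \<Omega> f"
  unfolding locally_integrable_def
proof (intro allI impI)
  fix K :: "'a set" assume "compact K"
  then have "set_integrable lborel K f"
    unfolding set_integrable_def
    by (intro borel_integrable_compact) (use assms continuous_on_subset in auto)
  then show "set_integrable lebesgue K f"
    unfolding set_integrable_def
    by (subst integrable_completion) (auto dest: borel_measurable_integrable)
qed

lemma test_function_smooth: "test_function \<Omega> \<phi> \<Longrightarrow> C_k k \<phi>"
  by (simp add: test_function_def smooth_function_def)

lemma test_function_differentiable: "test_function \<Omega> \<phi> \<Longrightarrow> \<phi> differentiable (at x)"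
  using test_function_smooth[of \<Omega> \<phi> "Suc 0"] by simp

lemma test_function_continuous: "test_function \<Omega> \<phi> \<Longrightarrow> continuous_on UNIV \<phi>"
  using test_function_smooth[of \<Omega> \<phi> 0] by simp

lemma test_function_continuous_derivative:
  "test_function \<Omega> \<phi> \<Longrightarrow> b \<in> Basis \<Longrightarrow> continuous_on UNIV (\<lambda>x. frechet_derivative \<phi> (at x) b)"
  using test_function_smooth[of \<Omega> \<phi> "Suc 0"] by simp

lemma frechet_derivative_zero_outside:
  assumes "closed K" and "\<And>x. x \<notin> K \<Longrightarrow> f x = 0" and "x \<notin> K"
  shows "frechet_derivative f (at x) = (\<lambda>_. 0)"
proof -
  have "((\<lambda>_. 0) has_derivative (\<lambda>_. 0)) (at x)" by simp
  then have "(f has_derivative (\<lambda>_. 0)) (at x)"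
    by (rule has_derivative_transform_within_open[of _ _ _ _ "- K"]) (use assms in auto)
  then show ?thesis using frechet_derivative_at by metis
qed

lemma test_function_support:
  assumes "test_function \<Omega> \<phi>"
  obtains K where "compact K" "K \<subseteq> \<Omega>" "\<And>x. x \<notin> K \<Longrightarrow> \<phi> x = 0"
    "\<And>x b. x \<notin> K \<Longrightarrow> frechet_derivative \<phi> (at x) b = 0"
proof (rule that[of "closure {x. \<phi> x \<noteq> 0}"])
  show 0: "\<phi> x = 0" if "x \<notin> closure {x. \<phi> x \<noteq> 0}" for x
    using that closure_subset[of "{x. \<phi> x \<noteq> 0}"] by auto
  show "frechet_derivative \<phi> (at x) b = 0" if "x \<notin> closure {x. \<phi> x \<noteq> 0}" for x b
    using frechet_derivative_zero_outside[OF closed_closure 0 that] by simp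
qed (use assms in \<open>auto simp: test_function_def\<close>)

lemma set_integrable_mult_test_function:
  assumes "locally_integrable \<Omega> f" "test_function \<Omega> \<phi>"
  shows "set_integrable lebesgue \<Omega> (\<lambda>x. f x * \<phi> x)"
    and "b \<in> Basis \<Longrightarrow> set_integrable lebesgue \<Omega> (\<lambda>x. f x * frechet_derivative \<phi> (at x) b)"
proof -
  obtain K where "compact K" "K \<subseteq> \<Omega>" "\<And>x. x \<notin> K \<Longrightarrow> \<phi> x = 0"
    "\<And>x b. x \<notin> K \<Longrightarrow> frechet_derivative \<phi> (at x) b = 0"
    by (rule test_function_support[OF assms(2)]) blast
  with assms show "set_integrable lebesgue \<Omega> (\<lambda>x. f x * \<phi> x)"
    "b \<in> Basis \<Longrightarrow> set_integrable lebesgue \<Omega> (\<lambda>x. f x * frechet_derivative \<phi> (at x) b)"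
    by (auto intro!: set_integrable_mult_compact_support[of _ _ _ K] test_function_continuous
       test_function_continuous_derivative[OF assms(2)])
qed

lemma is_weak_gradient_diff:
  assumes "is_weak_gradient \<Omega> u g" "is_weak_gradient \<Omega> v k"
  shows "is_weak_gradient \<Omega> (\<lambda>x. u x - v x) (\<lambda>x. g x - k x)"
  using assms
  by (auto simp: is_weak_gradient_def inner_diff_left left_diff_distrib locally_integrable_diff
      set_integrable_mult_test_function locally_integrable_inner set_integral_diff)

lemma is_weak_gradient_unique:
  assumes "open \<Omega>" "is_weak_gradient \<Omega> u g" "is_weak_gradient \<Omega> u k"
  shows "AE x in lebesgue. x \<in> \<Omega> \<longrightarrow> g x = k x"
proof -
  have "AE x in lebesgue. x \<in> \<Omega> \<longrightarrow> (g x - k x) \<bullet> b = 0" if "b \<in> Basis" for b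
  proof (rule fundamental_lemma_calculus_of_variations[OF \<open>open \<Omega>\<close>])
    have w: "is_weak_gradient \<Omega> (\<lambda>x. 0) (\<lambda>x. g x - k x)"
      using is_weak_gradient_diff[OF assms(2,3)] by simp
    then show "locally_integrable \<Omega> (\<lambda>x. (g x - k x) \<bullet> b)"
      by (simp add: is_weak_gradient_def locally_integrable_inner)
    show "(LINT x:\<Omega>|lebesgue. (g x - k x) \<bullet> b * \<phi> x) = 0" if "test_function \<Omega> \<phi>" for \<phi>
      using w that \<open>b \<in> Basis\<close> by (auto simp: is_weak_gradient_def)
  qed
  then have "AE x in lebesgue. \<forall>b\<in>Basis. x \<in> \<Omega> \<longrightarrow> (g x - k x) \<bullet> b = 0"
    by (subst AE_ball_countable) (auto intro: countable_finite)
  then show ?thesis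
    by eventually_elim (auto simp: inner_diff_left intro: euclidean_eqI)
qed

text \<open>The energy is defined through a choice among the weak gradients.  By uniqueness, any weak gradient at
  hand computes it; all statements about energies below go through this lemma.\<close>
lemma dirichlet_energy_eq:
  assumes "open \<Omega>" "is_weak_gradient \<Omega> u g"
  shows "dirichlet_energy \<Omega> u = (LINT x:\<Omega>|lebesgue. (norm (g x))\<^sup>2)"
proof -
  have w: "is_weak_gradient \<Omega> u (weak_grad \<Omega> u)"
    unfolding weak_grad_def by (rule someI[of _ g]) (rule assms(2))
  have m: "(\<lambda>x. indicator \<Omega> x *\<^sub>R (norm (k x))\<^sup>2) \<in> borel_measurable lebesgue"
    if "is_weak_gradient \<Omega> u k" for k
  proof -
    have "(\<lambda>x. indicator \<Omega> x *\<^sub>R k x) \<in> borel_measurable lebesgue"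
      using locally_integrable_measurable[OF assms(1), of k] that
      by (simp add: is_weak_gradient_def set_borel_measurable_def)
    then have "(\<lambda>x. (norm (indicator \<Omega> x *\<^sub>R k x))\<^sup>2) \<in> borel_measurable lebesgue" by measurable
    moreover have "(norm (indicator \<Omega> x *\<^sub>R k x))\<^sup>2 = indicator \<Omega> x *\<^sub>R (norm (k x))\<^sup>2" for x
      by (simp add: indicator_def)
    ultimately show ?thesis by simp
  qed
  show ?thesis
    unfolding dirichlet_energy_def set_lebesgue_integral_def
    by (rule integral_cong_AE)
      (use m[OF w] m[OF assms(2)] is_weak_gradient_unique[OF assms(1) w assms(2)] in
        \<open>auto simp: indicator_def elim!: eventually_mono\<close>)
qed

text \<open>A test function on the smaller set and its derivatives vanish on the rest of the larger one.\<close>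
lemma is_weak_gradient_subset:
  assumes w: "is_weak_gradient \<Omega> u g" and sub: "\<Omega>' \<subseteq> \<Omega>"
  shows "is_weak_gradient \<Omega>' u g"
  unfolding is_weak_gradient_def
proof (intro conjI allI impI ballI)
  show "locally_integrable \<Omega>' u" "locally_integrable \<Omega>' g"
    using w sub by (auto simp: is_weak_gradient_def locally_integrable_def)
  fix \<phi> and b :: 'a assume \<phi>: "test_function \<Omega>' \<phi>" and b: "b \<in> Basis"
  obtain K where K: "K \<subseteq> \<Omega>'" "\<And>x. x \<notin> K \<Longrightarrow> \<phi> x = 0"
    "\<And>x b. x \<notin> K \<Longrightarrow> frechet_derivative \<phi> (at x) b = 0"
    by (rule test_function_support[OF \<phi>]) blast
  have "(LINT x:\<Omega>'|lebesgue. f x * \<phi> x) = (LINT x:\<Omega>|lebesgue. f x * \<phi> x)"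
    "(LINT x:\<Omega>'|lebesgue. f x * frechet_derivative \<phi> (at x) b)
      = (LINT x:\<Omega>|lebesgue. f x * frechet_derivative \<phi> (at x) b)" for f
    unfolding set_lebesgue_integral_def
    by (intro Bochner_Integration.integral_cong; use K sub in \<open>auto simp: indicator_def\<close>)+
  moreover have "test_function \<Omega> \<phi>" using \<phi> sub by (auto simp: test_function_def)
  ultimately show "(LINT x:\<Omega>'|lebesgue. u x * frechet_derivative \<phi> (at x) b) =
      - (LINT x:\<Omega>'|lebesgue. (g x \<bullet> b) * \<phi> x)"
    using w b by (simp add: is_weak_gradient_def)
qed

section \<open>Weak gradients of smooth functions\<close>

lemma lebesgue_integral_translate:
  fixes f :: "'a::euclidean_space \<Rightarrow> real"
  assumes "f \<in> borel_measurable borel"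
  shows "(LINT x|lborel. f (x + v)) = (LINT x|lborel. f x)"
    and "integrable lborel f \<Longrightarrow> integrable lborel (\<lambda>x. f (x + v))"
proof -
  have d: "lborel = distr lborel borel (\<lambda>x. x + v)"
    using lborel_distr_plus[of v] by (simp add: add.commute[of _ v])
  show "(LINT x|lborel. f (x + v)) = (LINT x|lborel. f x)"
    by (subst (2) d, subst integral_distr) (use assms in auto)
  assume "integrable lborel f"
  then show "integrable lborel (\<lambda>x. f (x + v))"
    by (subst (asm) d, subst (asm) integrable_distr_eq) (use assms in auto)
qed

text \<open>The integral of a difference quotient \<open>(F (x + t b) - F x) / t\<close> vanishes by translation invariance,
  and these quotients converge boundedly, on a fixed compact set, to the derivative.\<close>
lemma integral_directional_derivative_zero:
  fixes F :: "'a::euclidean_space \<Rightarrow> real"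
  assumes D: "\<And>x. (F has_derivative D x) (at x)" and cont: "continuous_on UNIV (\<lambda>x. D x b)"
    and K: "compact K" and zero: "\<And>x. x \<notin> K \<Longrightarrow> F x = 0"
  shows "(LINT x|lebesgue. D x b) = 0"
proof -
  have contF: "continuous_on UNIV F"
    by (intro continuous_at_imp_continuous_on ballI has_derivative_continuous[OF D])
  then have Fm[measurable]: "F \<in> borel_measurable borel" by (rule borel_measurable_continuous_onI)
  have Dm[measurable]: "(\<lambda>x. D x b) \<in> borel_measurable borel"
    using cont by (rule borel_measurable_continuous_onI)
  have Dzero: "D x b = 0" if "x \<notin> K" for x
  proof -
    have "frechet_derivative F (at x) = (\<lambda>_. 0)"
      by (rule frechet_derivative_zero_outside[OF compact_imp_closed[OF K] _ that]) (rule zero)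
    then show ?thesis using frechet_derivative_at[OF D[of x]] by simp
  qed
  have "integrable lborel (\<lambda>x. indicator K x *\<^sub>R F x)"
    by (rule borel_integrable_compact[OF K continuous_on_subset[OF contF]]) simp
  moreover have "indicator K x *\<^sub>R F x = F x" for x using zero[of x] by (auto simp: indicator_def)
  ultimately have Fint: "integrable lborel F" by (simp only:)
  have "compact ((\<lambda>x. D x b) ` K)"
    by (rule compact_continuous_image[OF continuous_on_subset[OF cont] K]) simp
  then obtain M where "\<And>x. x \<in> K \<Longrightarrow> \<bar>D x b\<bar> \<le> M"
    by (metis compact_imp_bounded bounded_iff imageI real_norm_def)
  then have M: "\<bar>D x b\<bar> \<le> max M 0" for x
    using Dzero[of x] by (cases "x \<in> K") force+
  define t where "t n = inverse (real (Suc n))" for n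
  have t: "t n > 0" "t n \<le> 1" for n by (auto simp: t_def field_simps)
  have t0: "t \<longlonglongrightarrow> 0" unfolding t_def[abs_def] by (rule LIMSEQ_inverse_real_of_nat)
  define q where "q n x = (F (x + t n *\<^sub>R b) - F x) / t n" for n x
  \<comment> \<open>Outside \<open>K'\<close> the whole segment from \<open>x\<close> to \<open>x + t n b\<close> misses \<open>K\<close>.\<close>
  define K' where "K' = (\<lambda>(x, s). x - s *\<^sub>R b) ` (K \<times> {0..1})"
  have K': "compact K'"
    unfolding K'_def using K
    by (auto intro!: compact_continuous_image compact_Times continuous_intros simp: case_prod_unfold)
  have line: "((\<lambda>s. F (x + s *\<^sub>R b)) has_derivative (\<lambda>h. h * D (x + s *\<^sub>R b) b)) (at s)" for x s
  proof -
    have "((\<lambda>s. x + s *\<^sub>R b) has_derivative (\<lambda>h. h *\<^sub>R b)) (at s)"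
      by (auto intro!: derivative_eq_intros)
    from has_derivative_compose[OF this D]
    show ?thesis using linear_scale[OF has_derivative_linear[OF D]] by simp
  qed
  have qM: "\<bar>q n x\<bar> \<le> max M 0" for n x
  proof -
    have "continuous_on {0..t n} (\<lambda>s. F (x + s *\<^sub>R b))"
      by (intro continuous_at_imp_continuous_on ballI has_derivative_continuous[OF line])
    then obtain s where "F (x + t n *\<^sub>R b) - F (x + 0 *\<^sub>R b) = (t n - 0) * D (x + s *\<^sub>R b) b"
      using mvt[OF t(1) _ line] by metis
    then have "F (x + t n *\<^sub>R b) - F x = t n * D (x + s *\<^sub>R b) b" by simp
    then show ?thesis using M t[of n] by (simp add: q_def)
  qed
  have qzero: "q n x = 0" if "x \<notin> K'" for n x
  proof -
    have "x + s *\<^sub>R b \<notin> K" if "s \<in> {0..1}" for s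
    proof
      assume "x + s *\<^sub>R b \<in> K"
      then have "x \<in> K'" unfolding K'_def using that by (intro image_eqI[of _ _ "(x + s *\<^sub>R b, s)"]) auto
      then show False using \<open>x \<notin> K'\<close> by simp
    qed
    from this[of 0] this[of "t n"] t[of n] show ?thesis by (simp add: q_def zero)
  qed
  have lim: "(\<lambda>n. q n x) \<longlonglongrightarrow> D x b" for x
  proof -
    have "((\<lambda>s. F (x + s *\<^sub>R b)) has_real_derivative D x b) (at 0)"
      unfolding has_field_derivative_def using line[of x 0]
      by (rule has_derivative_eq_rhs) (simp add: fun_eq_iff)
    then have "((\<lambda>h. (F (x + h *\<^sub>R b) - F x) / h) \<longlongrightarrow> D x b) (at 0)"
      by (simp add: DERIV_def)
    moreover have "filterlim t (at 0) sequentially"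
      using t0 t by (auto simp: filterlim_at intro!: always_eventually less_imp_neq[symmetric])
    ultimately show ?thesis unfolding q_def by (rule filterlim_compose)
  qed
  have qm[measurable]: "q n \<in> borel_measurable borel" for n
    unfolding q_def[abs_def] by measurable
  have "(\<lambda>n. LINT x|lborel. q n x) \<longlonglongrightarrow> (LINT x|lborel. D x b)"
  proof (rule integral_dominated_convergence[where w="\<lambda>x. indicator K' x *\<^sub>R max M 0"])
    show "integrable lborel (\<lambda>x. indicator K' x *\<^sub>R max M 0)"
      by (rule borel_integrable_compact[OF K']) simp
    show "AE x in lborel. norm (q n x) \<le> indicator K' x *\<^sub>R max M 0" for n
      using qM qzero by (auto simp: indicator_def)
  qed (use lim in auto)
  moreover have "(LINT x|lborel. q n x) = 0" for n
    using Fint lebesgue_integral_translate[OF Fm, of "t n *\<^sub>R b"]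
    by (simp add: q_def)
  ultimately have "(LINT x|lborel. D x b) = 0" by (simp add: LIMSEQ_const_iff)
  then show ?thesis by (subst integral_completion) auto
qed

text \<open>Integration by parts: the product of \<open>f\<close> with a test function has compact support, so its
  derivatives have integral \<open>0\<close>.\<close>
lemma is_weak_gradient_smooth:
  fixes f :: "'a::euclidean_space \<Rightarrow> real"
  assumes "smooth_function f"
  shows "is_weak_gradient \<Omega> f (\<lambda>x. \<Sum>b\<in>Basis. frechet_derivative f (at x) b *\<^sub>R b)"
  unfolding is_weak_gradient_def
proof (intro conjI allI impI ballI)
  have f1: "C_k (Suc 0) f" and f0: "continuous_on UNIV f"
    using assms C_k_continuous unfolding smooth_function_def by blast+
  have f': "continuous_on UNIV (\<lambda>x. frechet_derivative f (at x) b)" if "b \<in> Basis" for b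
    using f1 that by simp
  show lf: "locally_integrable \<Omega> f" using f0 by (rule locally_integrable_continuous)
  show "locally_integrable \<Omega> (\<lambda>x. \<Sum>b\<in>Basis. frechet_derivative f (at x) b *\<^sub>R b)"
    by (intro locally_integrable_continuous continuous_intros f')
  fix \<phi> and b :: 'a assume \<phi>: "test_function \<Omega> \<phi>" and b: "b \<in> Basis"
  obtain K where K: "compact K" "K \<subseteq> \<Omega>" "\<And>x. x \<notin> K \<Longrightarrow> \<phi> x = 0"
    "\<And>x b. x \<notin> K \<Longrightarrow> frechet_derivative \<phi> (at x) b = 0"
    by (rule test_function_support[OF \<phi>]) blast
  have off: "\<phi> x = 0" "frechet_derivative \<phi> (at x) b = 0" if "x \<notin> \<Omega>" for x
    using K that by blast+
  have ld: "locally_integrable \<Omega> (\<lambda>x. frechet_derivative f (at x) b)"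
    by (rule locally_integrable_continuous[OF f'[OF b]])
  have D\<phi>: "(\<phi> has_derivative frechet_derivative \<phi> (at x)) (at x)" for x
    using test_function_differentiable[OF \<phi>] by (simp add: frechet_derivative_works)
  have "(LINT x|lebesgue. f x * frechet_derivative \<phi> (at x) b + frechet_derivative f (at x) b * \<phi> x) = 0"
  proof (rule integral_directional_derivative_zero[OF has_derivative_mult[OF C_k_Suc_has_derivative[OF f1] D\<phi>] _ K(1)])
    show "continuous_on UNIV (\<lambda>x. f x * frechet_derivative \<phi> (at x) b + frechet_derivative f (at x) b * \<phi> x)"
      by (intro continuous_intros f0 f' b test_function_continuous[OF \<phi>]
          test_function_continuous_derivative[OF \<phi>])
  qed (simp add: K)
  also have "(\<lambda>x. f x * frechet_derivative \<phi> (at x) b + frechet_derivative f (at x) b * \<phi> x)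
     = (\<lambda>x. indicator \<Omega> x *\<^sub>R (f x * frechet_derivative \<phi> (at x) b + frechet_derivative f (at x) b * \<phi> x))"
    using off by (auto simp: indicator_def fun_eq_iff)
  finally have "(LINT x:\<Omega>|lebesgue. f x * frechet_derivative \<phi> (at x) b + frechet_derivative f (at x) b * \<phi> x) = 0"
    unfolding set_lebesgue_integral_def .
  then have "(LINT x:\<Omega>|lebesgue. f x * frechet_derivative \<phi> (at x) b)
     + (LINT x:\<Omega>|lebesgue. frechet_derivative f (at x) b * \<phi> x) = 0"
    by (subst (asm) set_integral_add(2))
      (use set_integrable_mult_test_function[OF lf \<phi>] set_integrable_mult_test_function[OF ld \<phi>] b in auto)
  then show "(LINT x:\<Omega>|lebesgue. f x * frechet_derivative \<phi> (at x) b) =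
     - (LINT x:\<Omega>|lebesgue. ((\<Sum>b\<in>Basis. frechet_derivative f (at x) b *\<^sub>R b) \<bullet> b) * \<phi> x)"
    using b by (simp add: inner_sum_left inner_Basis if_distrib cong: if_cong)
qed

section \<open>Dilations\<close>

text \<open>For a profile \<open>h\<close> this enlarges the region below the graph by the factor \<open>c\<close>.  The factor in front
  of \<open>u\<close> keeps gradients unchanged and preserves the boundary condition \<open>u(x,0) = x\<close>.\<close>
definition dilate :: "real \<Rightarrow> ('a::real_vector \<Rightarrow> real) \<Rightarrow> 'a \<Rightarrow> real" where
  "dilate c u x = c * u (x /\<^sub>R c)"

definition dilate_set :: "real \<Rightarrow> 'a::real_vector set \<Rightarrow> 'a set" where
  "dilate_set c A = (\<lambda>x. x /\<^sub>R c) -` A"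

lemma lebesgue_dilation:
  assumes "c > 0"
  shows "(lebesgue :: 'a::euclidean_space measure) =
    density (distr lebesgue lebesgue (\<lambda>x. x /\<^sub>R c)) (\<lambda>_. ennreal (inverse c ^ DIM('a)))"
proof -
  have "(\<lambda>x::'a. 0 + (\<Sum>j\<in>Basis. (inverse c * (x \<bullet> j)) *\<^sub>R j)) = (\<lambda>x. x /\<^sub>R c)"
    by (simp add: euclidean_representation flip: scaleR_scaleR scaleR_sum_right)
  then show ?thesis
    using lebesgue_affine_euclidean[of "\<lambda>_. inverse c" "0::'a"] assms by simp
qed

lemma measurable_dilation: "(\<lambda>x::'a::euclidean_space. x /\<^sub>R c) \<in> lebesgue \<rightarrow>\<^sub>M lebesgue"
  using lebesgue_measurable_scaling[of "inverse c"] by simp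

lemma borel_measurable_dilation_iff:
  fixes f :: "'a::euclidean_space \<Rightarrow> 'b::topological_space"
  assumes "c > 0"
  shows "(\<lambda>x. f (x /\<^sub>R c)) \<in> borel_measurable lebesgue \<longleftrightarrow> f \<in> borel_measurable lebesgue"
proof
  assume f: "(\<lambda>x. f (x /\<^sub>R c)) \<in> borel_measurable lebesgue"
  have "(\<lambda>x. f ((x /\<^sub>R inverse c) /\<^sub>R c)) \<in> borel_measurable lebesgue"
    by (rule measurable_compose[OF measurable_dilation f])
  then show "f \<in> borel_measurable lebesgue" using assms by simp
next
  assume "f \<in> borel_measurable lebesgue"
  then show "(\<lambda>x. f (x /\<^sub>R c)) \<in> borel_measurable lebesgue"
    by (rule measurable_compose[OF measurable_dilation])
qed

lemma
  fixes f :: "'a::euclidean_space \<Rightarrow> 'b::{banach, second_countable_topology}"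
  assumes "c > 0"
  shows integrable_dilation_iff:
      "integrable lebesgue (\<lambda>x. f (x /\<^sub>R c)) \<longleftrightarrow> integrable lebesgue f"
    and integral_dilation:
      "(LINT x|lebesgue. f (x /\<^sub>R c)) = c ^ DIM('a) *\<^sub>R (LINT x|lebesgue. f x)"
proof -
  let ?k = "inverse c ^ DIM('a)"
  have k: "?k > 0" using assms by simp
  have meas: "integrable lebesgue (\<lambda>x. f (x /\<^sub>R c)) \<longleftrightarrow> integrable lebesgue f" (is ?int)
    "(LINT x|lebesgue. f (x /\<^sub>R c)) = c ^ DIM('a) *\<^sub>R (LINT x|lebesgue. f x)" (is ?eq)
    if f[measurable]: "f \<in> borel_measurable lebesgue"
  proof -
    note [measurable] = measurable_dilation[of c]
    have "integrable lebesgue f \<longleftrightarrow> integrable lebesgue (\<lambda>x. ?k *\<^sub>R f (x /\<^sub>R c))"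
      by (subst lebesgue_dilation[OF assms], subst integrable_density)
        (use k in \<open>auto simp: integrable_distr_eq\<close>)
    also have "\<dots> \<longleftrightarrow> integrable lebesgue (\<lambda>x. f (x /\<^sub>R c))"
    proof
      assume "integrable lebesgue (\<lambda>x. ?k *\<^sub>R f (x /\<^sub>R c))"
      then have "integrable lebesgue (\<lambda>x. inverse ?k *\<^sub>R ?k *\<^sub>R f (x /\<^sub>R c))"
        by (rule integrable_scaleR_right)
      then show "integrable lebesgue (\<lambda>x. f (x /\<^sub>R c))"
        using k by (simp only: scaleR_scaleR left_inverse[OF less_imp_neq[OF k, symmetric]] scaleR_one)
    qed auto
    finally show ?int by blast
    have "(LINT x|lebesgue. f x) = (LINT x|lebesgue. ?k *\<^sub>R f (x /\<^sub>R c))"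
      by (subst lebesgue_dilation[OF assms], subst integral_density)
        (use k in \<open>auto simp: integral_distr\<close>)
    then show ?eq using assms by (simp add: power_inverse)
  qed
  \<comment> \<open>Without measurability both functions fail to be integrable and both integrals are \<open>0\<close> by convention.\<close>
  have nmeas: "\<not> integrable lebesgue f" "\<not> integrable lebesgue (\<lambda>x. f (x /\<^sub>R c))"
    if "f \<notin> borel_measurable lebesgue"
    using that borel_measurable_integrable borel_measurable_dilation_iff[OF assms, of f] by blast+
  show "integrable lebesgue (\<lambda>x. f (x /\<^sub>R c)) \<longleftrightarrow> integrable lebesgue f"
    using meas(1) nmeas by blast
  show "(LINT x|lebesgue. f (x /\<^sub>R c)) = c ^ DIM('a) *\<^sub>R (LINT x|lebesgue. f x)"
  proof (cases "f \<in> borel_measurable lebesgue")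
    case False
    from nmeas[OF this] show ?thesis by (simp add: not_integrable_integral_eq)
  qed (rule meas(2))
qed

lemma indicator_dilate_set: "indicator (dilate_set c A) x = indicator A (x /\<^sub>R c)"
  by (simp add: dilate_set_def indicator_def)

lemma set_integrable_dilate_iff:
  fixes f :: "'a::euclidean_space \<Rightarrow> 'b::{banach, second_countable_topology}"
  assumes "c > 0"
  shows "set_integrable lebesgue (dilate_set c A) (\<lambda>x. f (x /\<^sub>R c)) \<longleftrightarrow> set_integrable lebesgue A f"
  unfolding set_integrable_def indicator_dilate_set
  by (rule integrable_dilation_iff[OF assms, of "\<lambda>x. indicator A x *\<^sub>R f x"])

lemma set_integral_dilate:
  fixes f :: "'a::euclidean_space \<Rightarrow> 'b::{banach, second_countable_topology}"
  assumes "c > 0"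
  shows "(LINT x:dilate_set c A|lebesgue. f (x /\<^sub>R c)) = c ^ DIM('a) *\<^sub>R (LINT x:A|lebesgue. f x)"
  unfolding set_lebesgue_integral_def indicator_dilate_set
  by (rule integral_dilation[OF assms, of "\<lambda>x. indicator A x *\<^sub>R f x"])

lemma in_L2_dilate:
  fixes f :: "'a::euclidean_space \<Rightarrow> 'b::euclidean_space"
  assumes "c > 0" and f: "in_L2 A f"
  shows "in_L2 (dilate_set c A) (\<lambda>x. f (x /\<^sub>R c))"
proof -
  have "set_borel_measurable lebesgue (dilate_set c A) (\<lambda>x. f (x /\<^sub>R c))"
    unfolding set_borel_measurable_def indicator_dilate_set
    using borel_measurable_dilation_iff[OF assms(1), of "\<lambda>x. indicator A x *\<^sub>R f x"] f
    by (simp add: in_L2_def set_borel_measurable_def)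
  then show ?thesis
    using f set_integrable_dilate_iff[OF assms(1), of A "\<lambda>x. (norm (f x))\<^sup>2"]
    by (simp add: in_L2_def)
qed

lemma in_L2_cmult:
  fixes f :: "'a::euclidean_space \<Rightarrow> real"
  assumes "in_L2 A f"
  shows "in_L2 A (\<lambda>x. c * f x)"
proof -
  have "(\<lambda>x. c * (indicator A x *\<^sub>R f x)) \<in> borel_measurable lebesgue"
    using assms unfolding in_L2_def set_borel_measurable_def
    by (intro borel_measurable_times borel_measurable_const) auto
  moreover have "set_integrable lebesgue A (\<lambda>x. c\<^sup>2 * (norm (f x))\<^sup>2)"
    using assms unfolding in_L2_def by (intro set_integrable_mult_right) auto
  ultimately show ?thesis
    by (simp add: in_L2_def set_borel_measurable_def power_mult_distrib mult.left_commute)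
qed

lemma in_L2_dilate_function: "c > 0 \<Longrightarrow> in_L2 A f \<Longrightarrow> in_L2 (dilate_set c A) (dilate c f)"
  for f :: "'a::euclidean_space \<Rightarrow> real"
  unfolding dilate_def[abs_def] by (intro in_L2_cmult in_L2_dilate)

lemma open_dilate_set:
  fixes A :: "'a::real_normed_vector set"
  assumes "open A" shows "open (dilate_set c A)"
  unfolding dilate_set_def
  by (rule open_vimage[OF assms]) (intro continuous_intros)

lemma locally_integrable_dilate:
  fixes f :: "'a::euclidean_space \<Rightarrow> 'b::euclidean_space"
  assumes "c > 0" and f: "locally_integrable A f"
  shows "locally_integrable (dilate_set c A) (\<lambda>x. f (x /\<^sub>R c))"
  unfolding locally_integrable_def
proof (intro allI impI)
  fix K assume K: "K \<subseteq> dilate_set c A" "compact K"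
  let ?K = "(\<lambda>x. x /\<^sub>R c) ` K"
  have "compact ?K" using K by (intro compact_continuous_image continuous_intros)
  moreover have "?K \<subseteq> A" using K by (auto simp: dilate_set_def)
  ultimately have "set_integrable lebesgue ?K f" using f by (simp add: locally_integrable_def)
  moreover have "dilate_set c ?K = K"
    using assms(1) by (auto simp: dilate_set_def dest: scaleR_left_imp_eq[rotated])
  ultimately show "set_integrable lebesgue K (\<lambda>x. f (x /\<^sub>R c))"
    using set_integrable_dilate_iff[OF assms(1), of ?K f] by simp
qed

lemma test_function_dilate:
  assumes "c > 0" and \<phi>: "test_function (dilate_set c A) \<phi>"
  shows "test_function A (\<lambda>x. \<phi> (c *\<^sub>R x))"
proof -
  obtain K where K: "compact K" "K \<subseteq> dilate_set c A" "\<And>x. x \<notin> K \<Longrightarrow> \<phi> x = 0"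
    by (rule test_function_support[OF \<phi>]) blast
  show ?thesis
  proof (rule test_functionI)
    show "smooth_function (\<lambda>x. \<phi> (c *\<^sub>R x))"
      using \<phi> by (simp add: test_function_def smooth_function_def C_k_dilation)
    show "compact ((\<lambda>x. x /\<^sub>R c) ` K)"
      using K by (intro compact_continuous_image continuous_intros)
    show "(\<lambda>x. x /\<^sub>R c) ` K \<subseteq> A" using K by (auto simp: dilate_set_def)
    show "\<phi> (c *\<^sub>R x) = 0" if "x \<notin> (\<lambda>x. x /\<^sub>R c) ` K" for x
      by (rule K(3)) (use that assms(1) in \<open>auto simp: image_iff\<close>)
  qed
qed

text \<open>A test function on the dilated set pulls back to one on the original set; the factor \<open>c\<close> in
  \<open>dilate\<close> cancels the factor that the chain rule produces.\<close>
lemma is_weak_gradient_dilate: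
  fixes u :: "'a::euclidean_space \<Rightarrow> real"
  assumes c: "c > 0" and w: "is_weak_gradient A u g"
  shows "is_weak_gradient (dilate_set c A) (dilate c u) (\<lambda>x. g (x /\<^sub>R c))"
  unfolding is_weak_gradient_def
proof (intro conjI allI impI ballI)
  have "locally_integrable (dilate_set c A) (\<lambda>x. u (x /\<^sub>R c))"
    using w by (intro locally_integrable_dilate c) (simp add: is_weak_gradient_def)
  then show "locally_integrable (dilate_set c A) (dilate c u)"
    unfolding locally_integrable_def dilate_def[abs_def] by simp
  show "locally_integrable (dilate_set c A) (\<lambda>x. g (x /\<^sub>R c))"
    using w by (intro locally_integrable_dilate c) (simp add: is_weak_gradient_def)
  fix \<phi> and b :: 'a assume \<phi>: "test_function (dilate_set c A) \<phi>" and b: "b \<in> Basis"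
  define \<psi> where "\<psi> x = \<phi> (c *\<^sub>R x)" for x
  have \<psi>: "test_function A \<psi>" unfolding \<psi>_def[abs_def] by (rule test_function_dilate[OF c \<phi>])
  have D: "frechet_derivative \<psi> (at x) b = c * frechet_derivative \<phi> (at (c *\<^sub>R x)) b" for x
    unfolding \<psi>_def[abs_def]
    by (rule frechet_derivative_dilation[OF test_function_differentiable[OF \<phi>]])
  have "(LINT x:dilate_set c A|lebesgue. dilate c u x * frechet_derivative \<phi> (at x) b)
      = (LINT x:dilate_set c A|lebesgue. u (x /\<^sub>R c) * frechet_derivative \<psi> (at (x /\<^sub>R c)) b)"
    using c by (simp add: dilate_def D mult_ac)
  also have "\<dots> = c ^ DIM('a) * (LINT x:A|lebesgue. u x * frechet_derivative \<psi> (at x) b)"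
    using set_integral_dilate[OF c, of A "\<lambda>x. u x * frechet_derivative \<psi> (at x) b"] by simp
  also have "\<dots> = - (c ^ DIM('a) * (LINT x:A|lebesgue. (g x \<bullet> b) * \<psi> x))"
    using w \<psi> b by (simp add: is_weak_gradient_def)
  also have "\<dots> = - (LINT x:dilate_set c A|lebesgue. (g (x /\<^sub>R c) \<bullet> b) * \<psi> (x /\<^sub>R c))"
    using set_integral_dilate[OF c, of A "\<lambda>x. (g x \<bullet> b) * \<psi> x"] by simp
  finally show "(LINT x:dilate_set c A|lebesgue. dilate c u x * frechet_derivative \<phi> (at x) b)
      = - (LINT x:dilate_set c A|lebesgue. (g (x /\<^sub>R c) \<bullet> b) * \<phi> x)"
    using c by (simp add: \<psi>_def)
qed

text \<open>The gradient is only transported, so the energy scales like volume: by \<open>c\<^sup>2\<close> in the plane, but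
  only by \<open>c\<close> on the line.  This difference of exponents drives the whole proof.\<close>
lemma dirichlet_energy_dilate:
  fixes u :: "'a::euclidean_space \<Rightarrow> real"
  assumes c: "c > 0" and A: "open A" and w: "is_weak_gradient A u g"
  shows "dirichlet_energy (dilate_set c A) (dilate c u) = c ^ DIM('a) * dirichlet_energy A u"
  unfolding dirichlet_energy_eq[OF A w]
    dirichlet_energy_eq[OF open_dilate_set[OF A] is_weak_gradient_dilate[OF c w]]
  using set_integral_dilate[OF c, of A "\<lambda>x. (norm (g x))\<^sup>2"] by simp

lemma in_H1_dilate:
  fixes u :: "'a::euclidean_space \<Rightarrow> real"
  assumes "c > 0" "in_H1 A u"
  shows "in_H1 (dilate_set c A) (dilate c u)"
  using assms is_weak_gradient_dilate[OF assms(1), of A u] in_L2_dilate[OF assms(1), of A]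
    in_L2_dilate_function[OF assms(1), of A u]
  unfolding in_H1_def by blast

lemma dilate_set_interval: "c > 0 \<Longrightarrow> dilate_set c {a<..<b} = {c * a<..<c * b}"
  by (auto simp: dilate_set_def field_simps)

lemma dilate_set_rectangle:
  "c > 0 \<Longrightarrow> dilate_set c ({a<..<b} \<times> {0<..<d}) = {c * a<..<c * b} \<times> {0<..<c * d}"
  for d :: real
  by (auto simp: dilate_set_def field_simps)

lemma dilate_set_UNIV: "dilate_set c UNIV = UNIV"
  by (simp add: dilate_set_def)

lemma Omega_dilate: "c > 0 \<Longrightarrow> Omega (dilate c h) = dilate_set c (Omega h)"
  by (auto simp: dilate_set_def Omega_def dilate_def field_simps zero_less_mult_iff)

text \<open>Dilating the approximating functions gives approximating functions.  Scaling the energy of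
  \<open>\<phi> n - u\<close> requires that this function have a weak gradient, which is where the classical gradient
  of \<open>\<phi> n\<close> enters.\<close>
lemma has_bottom_trace_dilate:
  assumes c: "c > 0" and tr: "has_bottom_trace a b d u T"
  shows "has_bottom_trace (c * a) (c * b) (c * d) (dilate c u) (dilate c T)"
proof -
  let ?R = "{a<..<b} \<times> {0<..<d}"
  have opn: "open ?R" by (intro open_Times) auto
  note R = dilate_set_rectangle[OF c, of a b d] and I = dilate_set_interval[OF c, of a b]
  obtain \<phi> where \<phi>: "\<And>n::nat. smooth_function (\<phi> n)"
      and lim1: "(\<lambda>n. H1_norm_sq ?R (\<lambda>z. \<phi> n z - u z)) \<longlonglongrightarrow> 0"
      and lim2: "(\<lambda>n. LINT x:{a<..<b}|lebesgue. (\<phi> n (x, 0) - T x)\<^sup>2) \<longlonglongrightarrow> 0"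
      and u: "in_H1 ?R u" and T: "in_L2 {a<..<b} T"
    using tr unfolding has_bottom_trace_def by blast
  obtain g where g: "is_weak_gradient ?R u g" using u by (auto simp: in_H1_def)
  define P where "P n = (LINT z:?R|lebesgue. (\<phi> n z - u z)\<^sup>2)" for n
  define Q where "Q n = dirichlet_energy ?R (\<lambda>z. \<phi> n z - u z)" for n
  \<comment> \<open>The two parts of the norm scale with different powers of \<open>c\<close>, so their convergence is separated.\<close>
  have PQ: "H1_norm_sq ?R (\<lambda>z. \<phi> n z - u z) = P n + Q n" for n
    by (simp add: H1_norm_sq_def P_def Q_def)
  have nn: "P n \<ge> 0" "Q n \<ge> 0" for n
    unfolding P_def Q_def dirichlet_energy_def set_lebesgue_integral_def
    by (auto intro!: Bochner_Integration.integral_nonneg)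
  have sum0: "(\<lambda>n. P n + Q n) \<longlonglongrightarrow> 0" using lim1 by (simp add: PQ)
  have P0: "P \<longlonglongrightarrow> 0" and Q0: "Q \<longlonglongrightarrow> 0"
    by (rule tendsto_sandwich[OF _ _ tendsto_const sum0]; use nn in simp)+
  have diff: "(\<lambda>z. dilate c (\<phi> n) z - dilate c u z) = dilate c (\<lambda>z. \<phi> n z - u z)" for n
    by (auto simp: dilate_def fun_eq_iff algebra_simps)
  have "H1_norm_sq (dilate_set c ?R) (\<lambda>z. dilate c (\<phi> n) z - dilate c u z) = c\<^sup>2 * (c\<^sup>2 * P n) + c\<^sup>2 * Q n" for n
  proof -
    have "(LINT z:dilate_set c ?R|lebesgue. (dilate c (\<lambda>z. \<phi> n z - u z) z)\<^sup>2) = c\<^sup>2 * (c\<^sup>2 * P n)"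
      using set_integral_dilate[OF c, of ?R "\<lambda>z. (\<phi> n z - u z)\<^sup>2"]
      by (simp add: dilate_def power_mult_distrib P_def power4_eq_xxxx power2_eq_square[of c])
    moreover have "dirichlet_energy (dilate_set c ?R) (dilate c (\<lambda>z. \<phi> n z - u z)) = c\<^sup>2 * Q n"
      using dirichlet_energy_dilate[OF c opn is_weak_gradient_diff[OF is_weak_gradient_smooth[OF \<phi>] g]]
      by (simp add: Q_def power2_eq_square)
    ultimately show ?thesis by (simp add: H1_norm_sq_def diff)
  qed
  moreover have "(\<lambda>n. c\<^sup>2 * (c\<^sup>2 * P n) + c\<^sup>2 * Q n) \<longlonglongrightarrow> 0"
    using tendsto_add[OF tendsto_mult_left[OF tendsto_mult_left[OF P0, of "c\<^sup>2"], of "c\<^sup>2"] tendsto_mult_left[OF Q0, of "c\<^sup>2"]]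
    by simp
  ultimately have 1: "(\<lambda>n. H1_norm_sq (dilate_set c ?R) (\<lambda>z. dilate c (\<phi> n) z - dilate c u z)) \<longlonglongrightarrow> 0"
    by simp
  have "(LINT x:dilate_set c {a<..<b}|lebesgue. (dilate c (\<phi> n) (x, 0) - dilate c T x)\<^sup>2)
      = c\<^sup>2 * (c * (LINT x:{a<..<b}|lebesgue. (\<phi> n (x, 0) - T x)\<^sup>2))" for n
  proof -
    have "(dilate c (\<phi> n) (x, 0) - dilate c T x)\<^sup>2 = c\<^sup>2 * (\<phi> n (x /\<^sub>R c, 0) - T (x /\<^sub>R c))\<^sup>2" for x
      unfolding dilate_def right_diff_distrib[symmetric] power_mult_distrib by simp
    then show ?thesis
      using set_integral_dilate[OF c, of "{a<..<b}" "\<lambda>x. (\<phi> n (x, 0) - T x)\<^sup>2"] by simp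
  qed
  then have 2: "(\<lambda>n. LINT x:dilate_set c {a<..<b}|lebesgue. (dilate c (\<phi> n) (x, 0) - dilate c T x)\<^sup>2) \<longlonglongrightarrow> 0"
    using tendsto_mult_left[OF tendsto_mult_left[OF lim2, of c], of "c\<^sup>2"] by simp
  have "smooth_function (dilate c (\<phi> n))" for n
    using \<phi> unfolding smooth_function_def dilate_def[abs_def]
    by (intro allI C_k_cmult C_k_dilation) blast
  then show ?thesis
    unfolding has_bottom_trace_def
    using in_H1_dilate[OF c u, unfolded R] in_L2_dilate_function[OF c T, unfolded I]
      1[unfolded R] 2[unfolded I]
    by (intro conjI exI[of _ "\<lambda>n. dilate c (\<phi> n)"]) simp_all
qed

lemma open_Omega:
  assumes "continuous_on UNIV h"
  shows "open (Omega h)"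
proof -
  have "Omega h = {z. 0 < snd z} \<inter> {z. snd z < h (fst z)}" by (auto simp: Omega_def)
  moreover have "open {z :: real \<times> real. 0 < snd z}"
    by (intro open_Collect_less continuous_intros)
  moreover have "open {z :: real \<times> real. snd z < h (fst z)}"
    by (intro open_Collect_less continuous_intros continuous_on_compose2[OF assms]) auto
  ultimately show ?thesis by (simp only: open_Int)
qed

lemma admissible_dilate:
  assumes c: "c > 0" and uh: "(u, h) \<in> admissible V"
  shows "(dilate c u, dilate c h) \<in> admissible (c\<^sup>2 * V)"
proof -
  have h: "in_H1 UNIV h" "continuous_on UNIV h" "\<And>x. 0 \<le> h x" "has_bochner_integral lebesgue h V"
    and u: "in_H1 (Omega h) u"
    and tr: "\<And>a b d. a < b \<Longrightarrow> 0 < d \<Longrightarrow> {a<..<b} \<times> {0<..<d} \<subseteq> Omega h \<Longrightarrow> has_bottom_trace a b d u (\<lambda>x. x)"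
    using uh by (auto simp: admissible_def)
  have "in_H1 UNIV (dilate c h)" using in_H1_dilate[OF c h(1)] by (simp add: dilate_set_UNIV)
  moreover have "continuous_on UNIV (dilate c h)"
    unfolding dilate_def[abs_def]
    by (intro continuous_intros continuous_on_compose2[OF h(2)]) auto
  moreover have "\<forall>x. 0 \<le> dilate c h x" using c h(3) by (simp add: dilate_def)
  moreover have "in_H1 (Omega (dilate c h)) (dilate c u)"
    using in_H1_dilate[OF c u] by (simp add: Omega_dilate c)
  moreover have "has_bochner_integral lebesgue (dilate c h) (c\<^sup>2 * V)"
    using h(4) integrable_dilation_iff[OF c, of h] integral_dilation[OF c, of h]
    by (simp add: has_bochner_integral_iff dilate_def[abs_def] power2_eq_square)
  moreover have "has_bottom_trace a b d (dilate c u) (\<lambda>x. x)"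
    if "a < b" "0 < d" "{a<..<b} \<times> {0<..<d} \<subseteq> Omega (dilate c h)" for a b d
  proof -
    have sub: "dilate_set c ({a / c<..<b / c} \<times> {0<..<d / c}) \<subseteq> dilate_set c (Omega h)"
      using that c by (simp add: dilate_set_rectangle Omega_dilate)
    have "{a / c<..<b / c} \<times> {0<..<d / c} \<subseteq> Omega h"
    proof (intro subsetI)
      fix z assume "z \<in> {a / c<..<b / c} \<times> {0<..<d / c}"
      then have "c *\<^sub>R z \<in> dilate_set c ({a / c<..<b / c} \<times> {0<..<d / c})"
        using c by (simp add: dilate_set_def)
      with sub have "c *\<^sub>R z \<in> dilate_set c (Omega h)" by blast
      then show "z \<in> Omega h" using c by (simp add: dilate_set_def)
    qed
    then have "has_bottom_trace (a / c) (b / c) (d / c) u (\<lambda>x. x)"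
      using that c by (intro tr) (auto simp: divide_strict_right_mono)
    from has_bottom_trace_dilate[OF c this] show ?thesis
      using c by (simp add: dilate_def[abs_def] flip: mult.assoc)
  qed
  ultimately show ?thesis by (simp add: admissible_def)
qed

lemma bulk_energy_dilate:
  assumes "c > 0" and "(u, h) \<in> admissible V"
  shows "bulk_energy (dilate c u) (dilate c h) = c\<^sup>2 * bulk_energy u h"
proof -
  obtain g where "is_weak_gradient (Omega h) u g" "continuous_on UNIV h"
    using assms(2) by (auto simp: admissible_def in_H1_def)
  from dirichlet_energy_dilate[OF assms(1) open_Omega[OF this(2)] this(1)]
  show ?thesis using assms(1) by (simp add: bulk_energy_def Omega_dilate power2_eq_square)
qed

lemma surface_energy_dilate:
  assumes "c > 0" and "(u, h) \<in> admissible V"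
  shows "surface_energy (dilate c h) = c * surface_energy h"
proof -
  obtain g where "is_weak_gradient UNIV h g"
    using assms(2) by (auto simp: admissible_def in_H1_def)
  from dirichlet_energy_dilate[OF assms(1) open_UNIV this]
  show ?thesis using assms(1) by (simp add: surface_energy_def dilate_set_UNIV)
qed

section \<open>Continuous functions with a weak derivative on the line\<close>

lemma weak_derivative_identity:
  fixes w g \<phi> :: "real \<Rightarrow> real"
  assumes "is_weak_gradient UNIV w g" "test_function UNIV \<phi>"
  shows "(LINT x|lebesgue. w x * frechet_derivative \<phi> (at x) 1) = - (LINT x|lebesgue. g x * \<phi> x)"
proof -
  have "(LINT x:UNIV|lebesgue. w x * frechet_derivative \<phi> (at x) 1) =
      - (LINT x:UNIV|lebesgue. (g x \<bullet> 1) * \<phi> x)"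
    using assms unfolding is_weak_gradient_def by simp
  then show ?thesis by (simp add: set_lebesgue_integral_def)
qed

text \<open>After the substitution \<open>x = p + (s + k) / (n + 1)\<close> the point of evaluation of \<open>w\<close> tends to \<open>p\<close>
  while the weight \<open>\<theta>'\<close> stays fixed.  The shift \<open>k\<close> allows the mass to lie on either side of \<open>p\<close>.\<close>
lemma approximate_identity:
  fixes w \<theta>' :: "real \<Rightarrow> real"
  assumes w: "continuous_on UNIV w" and \<theta>': "continuous_on UNIV \<theta>'"
    and zero: "\<And>x. x \<notin> {0..1} \<Longrightarrow> \<theta>' x = 0" and k: "k \<in> {-1..0}"
    and one: "(LINT s|lborel. \<theta>' s) = 1"
  shows "(\<lambda>n. LINT x|lebesgue. w x * (real (Suc n) * \<theta>' (real (Suc n) * (x - p) - k))) \<longlonglongrightarrow> w p"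
proof -
  have [measurable]: "w \<in> borel_measurable borel" "\<theta>' \<in> borel_measurable borel"
    using w \<theta>' by (auto intro: borel_measurable_continuous_onI)
  have eq: "(LINT x|lebesgue. w x * (real (Suc n) * \<theta>' (real (Suc n) * (x - p) - k)))
     = (LINT s|lborel. w (p + (s + k) / real (Suc n)) * \<theta>' s)" for n
  proof -
    let ?N = "real (Suc n)"
    have "(LINT x|lebesgue. w x * (?N * \<theta>' (?N * (x - p) - k)))
        = (LINT x|lborel. w x * (?N * \<theta>' (?N * (x - p) - k)))"
      by (rule integral_completion) measurable
    also have "\<dots> = (1 / ?N) * (LINT s|lborel. w (p + k / ?N + (1 / ?N) * s) *
        (?N * \<theta>' (?N * (p + k / ?N + (1 / ?N) * s - p) - k)))"
      by (subst lborel_integral_real_affine[of "1 / ?N" _ "p + k / ?N"]) auto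
    also have "(\<lambda>s. w (p + k / ?N + (1 / ?N) * s) * (?N * \<theta>' (?N * (p + k / ?N + (1 / ?N) * s - p) - k)))
       = (\<lambda>s. ?N * (w (p + (s + k) / ?N) * \<theta>' s))"
      by (auto simp: fun_eq_iff distrib_left add_divide_distrib add_ac simp del: of_nat_Suc)
    finally show ?thesis by simp
  qed
  obtain M where M: "\<And>x. x \<in> {p - 1..p + 1} \<Longrightarrow> \<bar>w x\<bar> \<le> M"
  proof -
    have "compact (w ` {p - 1..p + 1})"
      by (rule compact_continuous_image[OF continuous_on_subset[OF w]]) auto
    then show ?thesis using that by (metis compact_imp_bounded bounded_iff imageI real_norm_def)
  qed
  have \<theta>int: "integrable lborel \<theta>'" using one not_integrable_integral_eq by fastforce
  have "(\<lambda>n. LINT s|lborel. w (p + (s + k) / real (Suc n)) * \<theta>' s) \<longlonglongrightarrow> (LINT s|lborel. w p * \<theta>' s)"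
  proof (rule integral_dominated_convergence[where w="\<lambda>s. M * \<bar>\<theta>' s\<bar>"])
    show "integrable lborel (\<lambda>s. M * \<bar>\<theta>' s\<bar>)" using \<theta>int by simp
    have "(\<lambda>n. w (p + (s + k) / real (Suc n)) * \<theta>' s) \<longlonglongrightarrow> w p * \<theta>' s" for s
    proof -
      have "(\<lambda>n. p + (s + k) * inverse (real (Suc n))) \<longlonglongrightarrow> p + (s + k) * 0"
        by (intro tendsto_intros LIMSEQ_inverse_real_of_nat)
      then have "(\<lambda>n. p + (s + k) / real (Suc n)) \<longlonglongrightarrow> p" by (simp add: divide_inverse)
      moreover have "isCont w p" using w by (simp add: continuous_on_eq_continuous_at)
      ultimately show ?thesis by (intro tendsto_intros isCont_tendsto_compose[of p w])
    qed
    then show "AE s in lborel. (\<lambda>n. w (p + (s + k) / real (Suc n)) * \<theta>' s) \<longlonglongrightarrow> w p * \<theta>' s" by simp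
    have "\<bar>w (p + (s + k) / real (Suc n))\<bar> * \<bar>\<theta>' s\<bar> \<le> M * \<bar>\<theta>' s\<bar>" for n s
    proof (cases "s \<in> {0..1}")
      case True
      then have "s + k \<le> 1 * real (Suc n)" "(-1) * real (Suc n) \<le> s + k" using k by auto
      then have "(s + k) / real (Suc n) \<in> {-1..1}"
        by (simp only: atLeastAtMost_iff pos_divide_le_eq[of "real (Suc n)"] pos_le_divide_eq[of "real (Suc n)"] of_nat_0_less_iff zero_less_Suc simp_thms)
      then show ?thesis by (intro mult_right_mono M) auto
    qed (simp add: zero)
    then show "AE s in lborel. norm (w (p + (s + k) / real (Suc n)) * \<theta>' s) \<le> M * \<bar>\<theta>' s\<bar>" for n
      by (simp add: abs_mult)
  qed measurable
  then show ?thesis unfolding eq by (simp add: one)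
qed

text \<open>Testing the weak derivative with a smooth approximation \<open>\<phi> n\<close> of the indicator of the interval
  puts the integral of \<open>g\<close> on one side; on the other, the derivative of \<open>\<phi> n\<close> is the difference of two
  approximate identities, at \<open>a\<close> and at \<open>b\<close>, which evaluate \<open>w\<close> there by continuity.\<close>
lemma weak_derivative_FTC:
  fixes w g :: "real \<Rightarrow> real"
  assumes w: "continuous_on UNIV w" and wg: "is_weak_gradient UNIV w g" and ab: "a < b"
  shows "(LINT x:{a<..<b}|lebesgue. g x) = w b - w a"
proof -
  obtain \<theta> \<theta>' :: "real \<Rightarrow> real" where C: "\<And>k. C_k k \<theta>" and cont': "continuous_on UNIV \<theta>'"
    and D: "\<And>x. (\<theta> has_real_derivative \<theta>' x) (at x)"
    and left: "\<And>x. x \<le> 0 \<Longrightarrow> \<theta> x = 0" and right: "\<And>x. x \<ge> 1 \<Longrightarrow> \<theta> x = 1"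
    and bounds: "\<And>x. 0 \<le> \<theta> x" "\<And>x. \<theta> x \<le> 1" and zero: "\<And>x. x \<notin> {0..1} \<Longrightarrow> \<theta>' x = 0"
    by (rule smooth_step_exists) blast
  have one: "(LINT s|lborel. \<theta>' s) = 1"
  proof -
    have "(LINT s|lborel. \<theta>' s * indicator {0..1} s) = \<theta> 1 - \<theta> 0"
      by (rule integral_FTC_Icc_real)
        (use D cont' in \<open>auto intro: has_field_derivative_at_within simp: continuous_on_eq_continuous_at\<close>)
    moreover have "\<theta>' s * indicator {0..1} s = \<theta>' s" for s
      using zero[of s] by (auto simp: indicator_def)
    ultimately show ?thesis using left right by simp
  qed
  \<comment> \<open>The step at \<open>b\<close> is shifted so that it is complete at \<open>b\<close>: the limit is then exactly the indicator of the open interval.\<close>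
  define \<phi> where "\<phi> n x = \<theta> (real (Suc n) * (x - a)) - \<theta> (real (Suc n) * (x - b) + 1)" for n x
  define \<alpha> where "\<alpha> n x = real (Suc n) * \<theta>' (real (Suc n) * (x - a) - 0)" for n x
  define \<beta> where "\<beta> n x = real (Suc n) * \<theta>' (real (Suc n) * (x - b) - (-1))" for n x
  have D\<phi>: "frechet_derivative (\<phi> n) (at x) 1 = \<alpha> n x - \<beta> n x" for n x
  proof -
    have 1: "((\<lambda>x. real (Suc n) * (x - a)) has_real_derivative real (Suc n)) (at x)"
      and 2: "((\<lambda>x. real (Suc n) * (x - b) + 1) has_real_derivative real (Suc n)) (at x)"
      by (auto intro!: derivative_eq_intros)
    have "(\<phi> n has_real_derivative \<alpha> n x - \<beta> n x) (at x)"
      unfolding \<phi>_def[abs_def] \<alpha>_def \<beta>_def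
      using DERIV_diff[OF DERIV_chain2[OF D 1] DERIV_chain2[OF D 2]]
      by (simp add: mult.commute del: of_nat_Suc)
    then have "(\<phi> n has_derivative (*) (\<alpha> n x - \<beta> n x)) (at x)"
      by (simp add: has_field_derivative_def)
    from frechet_derivative_at[OF this] show ?thesis by (metis mult.right_neutral)
  qed
  have small: "\<phi> n x = 0" if "x \<notin> {a - 1..b + 1}" for n x
  proof -
    have below: "N * y \<le> y" if "N \<ge> 1" "y \<le> 0" for N y :: real
      using mult_right_mono_neg[OF that] by simp
    have above: "N * y \<ge> y" if "N \<ge> 1" "y \<ge> 0" for N y :: real
      using mult_right_mono[OF that] by simp
    let ?N = "real (Suc n)"
    have N: "?N \<ge> 1" by simp
    have "x \<le> a - 1 \<or> x \<ge> b + 1" using that by auto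
    then consider "x \<le> a - 1" | "x \<ge> b + 1" by blast
    then show ?thesis
    proof cases
      case 1
      then have "?N * (x - a) \<le> 0" "?N * (x - b) + 1 \<le> 0"
        using below[OF N, of "x - a"] below[OF N, of "x - b"] ab by linarith+
      then show ?thesis unfolding \<phi>_def by (simp only: left diff_self)
    next
      case 2
      then have "?N * (x - b) + 1 \<ge> 1" "?N * (x - a) \<ge> 1"
        using above[OF N, of "x - b"] above[OF N, of "x - a"] ab by linarith+
      then show ?thesis unfolding \<phi>_def by (simp only: right diff_self)
    qed
  qed
  have \<phi>C: "smooth_function (\<phi> n)" for n
  proof -
    have "\<phi> n = (\<lambda>x. \<theta> (x \<bullet> real (Suc n) + - (real (Suc n) * a)) - \<theta> (x \<bullet> real (Suc n) + (1 - real (Suc n) * b)))"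
      by (auto simp: \<phi>_def fun_eq_iff algebra_simps simp del: of_nat_Suc)
    then show ?thesis
      unfolding smooth_function_def by (simp only:) (intro allI C_k_diff C_k_ridge C)
  qed
  have test: "test_function UNIV (\<phi> n)" for n
    by (rule test_functionI[OF \<phi>C compact_Icc[of "a - 1" "b + 1"]]) (use small in auto)
  have lw: "locally_integrable UNIV w" and lg: "locally_integrable UNIV g"
    using wg by (auto simp: is_weak_gradient_def)
  have far: "N * y - k \<notin> {0..1}" if "N \<ge> 1" "y < - 1 \<or> 1 < y" "k \<in> {-1..0}" for N y k :: real
    using that(2)
  proof
    assume "y < - 1"
    then have "N * y \<le> y" using mult_right_mono_neg[of 1 N y] that(1) by simp
    then have "N * y - k < 0" using \<open>y < - 1\<close> that(3) unfolding atLeastAtMost_iff by linarith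
    then show ?thesis by simp
  next
    assume "1 < y"
    then have "N * y \<ge> y" using mult_right_mono[of 1 N y] that(1) by simp
    then have "N * y - k > 1" using \<open>1 < y\<close> that(3) unfolding atLeastAtMost_iff by linarith
    then show ?thesis by simp
  qed
  have int: "integrable lebesgue (\<lambda>x. w x * \<alpha> n x)" "integrable lebesgue (\<lambda>x. w x * \<beta> n x)" for n
  proof -
    have *: "integrable lebesgue (\<lambda>x. w x * (real (Suc n) * \<theta>' (real (Suc n) * (x - p) - k)))"
      if "k \<in> {-1..0}" for p k
    proof -
      have "set_integrable lebesgue UNIV (\<lambda>x. w x * (real (Suc n) * \<theta>' (real (Suc n) * (x - p) - k)))"
      proof (rule set_integrable_mult_compact_support[OF lw _ compact_Icc[of "p - 1" "p + 1"]])
        show "continuous_on UNIV (\<lambda>x. real (Suc n) * \<theta>' (real (Suc n) * (x - p) - k))"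
          by (intro continuous_intros continuous_on_compose2[OF cont']) auto
        fix x assume "x \<notin> {p - 1..p + 1}"
        then have "x - p < - 1 \<or> 1 < x - p" by force
        then have "real (Suc n) * (x - p) - k \<notin> {0..1}"
          using far[of "real (Suc n)" "x - p" k] that by simp
        then show "real (Suc n) * \<theta>' (real (Suc n) * (x - p) - k) = 0" by (simp add: zero)
      qed simp
      then show ?thesis by (simp add: set_integrable_def)
    qed
    show "integrable lebesgue (\<lambda>x. w x * \<alpha> n x)" "integrable lebesgue (\<lambda>x. w x * \<beta> n x)"
      unfolding \<alpha>_def \<beta>_def by (rule *; simp)+
  qed
  have weak: "(LINT x|lebesgue. g x * \<phi> n x) = (LINT x|lebesgue. w x * \<beta> n x) - (LINT x|lebesgue. w x * \<alpha> n x)" for n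
    using weak_derivative_identity[OF wg test[of n]] by (simp add: D\<phi> right_diff_distrib int)
  have "(\<lambda>n. LINT x|lebesgue. w x * \<alpha> n x) \<longlonglongrightarrow> w a" "(\<lambda>n. LINT x|lebesgue. w x * \<beta> n x) \<longlonglongrightarrow> w b"
    unfolding \<alpha>_def \<beta>_def by (rule approximate_identity[OF w cont' zero _ one]; simp)+
  then have lim1: "(\<lambda>n. LINT x|lebesgue. g x * \<phi> n x) \<longlonglongrightarrow> w b - w a"
    unfolding weak by (intro tendsto_diff)
  have gint: "integrable lebesgue (\<lambda>x. indicator {a - 1..b + 1} x * g x)"
    using lg[unfolded locally_integrable_def set_integrable_def, rule_format, of "{a - 1..b + 1}"]
    by simp
  have eq: "g x * \<phi> n x = indicator {a - 1..b + 1} x * g x * \<phi> n x" for n x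
    using small[of x n] by (auto simp: indicator_def)
  have gm: "(\<lambda>x. g x * \<phi> n x) \<in> borel_measurable lebesgue" for n
    unfolding eq by (intro borel_measurable_times[OF borel_measurable_integrable[OF gint]]
      continuous_borel_measurable_lebesgue test_function_continuous[OF test])
  have bound: "\<bar>\<phi> n x\<bar> \<le> 1" for n x
    using bounds[of "real (Suc n) * (x - a)"] bounds[of "real (Suc n) * (x - b) + 1"]
    unfolding \<phi>_def abs_le_iff by linarith
  have lim: "(\<lambda>n. \<phi> n x) \<longlonglongrightarrow> indicator {a<..<b} x" for x
  proof -
    have big: "filterlim (\<lambda>n. real (Suc n) * c) at_top sequentially" if "c > 0" for c
      using that by (intro filterlim_at_top_mult_tendsto_pos[OF tendsto_const])
        (simp_all only: filterlim_compose[OF filterlim_real_sequentially filterlim_Suc])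
    have "\<forall>\<^sub>F n in sequentially. \<theta> (real (Suc n) * (x - a)) = indicator {a<..} x"
    proof (cases "x > a")
      case True
      then have "\<forall>\<^sub>F n in sequentially. 1 \<le> real (Suc n) * (x - a)"
        using big[of "x - a"] by (simp add: filterlim_at_top del: of_nat_Suc)
      then show ?thesis by eventually_elim (use True right in auto)
    next
      case False
      then have "real (Suc n) * (x - a) \<le> 0" for n by (simp add: mult_nonneg_nonpos del: of_nat_Suc)
      then show ?thesis using False left by (simp del: of_nat_Suc)
    qed
    moreover have "\<forall>\<^sub>F n in sequentially. \<theta> (real (Suc n) * (x - b) + 1) = indicator {b..} x"
    proof (cases "x < b")
      case True
      then have "\<forall>\<^sub>F n in sequentially. 1 \<le> real (Suc n) * (b - x)"
        using big[of "b - x"] by (simp add: filterlim_at_top del: of_nat_Suc)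
      then show ?thesis
      proof eventually_elim
        case (elim n)
        have "real (Suc n) * (x - b) = - (real (Suc n) * (b - x))" by (simp only: minus_diff_eq mult_minus_right[symmetric])
        with elim have "real (Suc n) * (x - b) + 1 \<le> 0" by linarith
        with True left show ?case by simp
      qed
    next
      case False
      then have "real (Suc n) * (x - b) + 1 \<ge> 1" for n by (simp del: of_nat_Suc)
      then show ?thesis using False right by (simp del: of_nat_Suc)
    qed
    ultimately have "\<forall>\<^sub>F n in sequentially. indicator {a<..<b} x = \<phi> n x"
      by eventually_elim (use ab in \<open>auto simp: \<phi>_def indicator_def simp del: of_nat_Suc\<close>)
    then show ?thesis by (rule Lim_transform_eventually[OF tendsto_const])
  qed
  have "(\<lambda>n. LINT x|lebesgue. g x * \<phi> n x) \<longlonglongrightarrow> (LINT x|lebesgue. g x * indicator {a<..<b} x)"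
  proof (rule integral_dominated_convergence[where w="\<lambda>x. \<bar>indicator {a - 1..b + 1} x * g x\<bar>"])
    show "integrable lebesgue (\<lambda>x. \<bar>indicator {a - 1..b + 1} x * g x\<bar>)" using gint by simp
    show "AE x in lebesgue. (\<lambda>n. g x * \<phi> n x) \<longlonglongrightarrow> g x * indicator {a<..<b} x"
      by (intro AE_I2 tendsto_mult tendsto_const lim)
    have "\<bar>indicator {a - 1..b + 1} x * g x\<bar> * \<bar>\<phi> n x\<bar> \<le> \<bar>indicator {a - 1..b + 1} x * g x\<bar> * 1" for n x
      by (intro mult_left_mono bound) simp
    then show "AE x in lebesgue. norm (g x * \<phi> n x) \<le> \<bar>indicator {a - 1..b + 1} x * g x\<bar>" for n
      by (subst eq) (simp add: abs_mult)
    have "(\<lambda>x. indicator {a<..<b} x * (indicator {a - 1..b + 1} x * g x)) \<in> borel_measurable lebesgue"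
      by (intro borel_measurable_times borel_measurable_indicator borel_measurable_integrable[OF gint]) simp
    moreover have "indicator {a<..<b} x * (indicator {a - 1..b + 1} x * g x) = g x * indicator {a<..<b} x" for x
      by (auto simp: indicator_def)
    ultimately show "(\<lambda>x. g x * indicator {a<..<b} x) \<in> borel_measurable lebesgue" by simp
  qed (rule gm)
  from LIMSEQ_unique[OF this lim1] show ?thesis
    by (simp add: set_lebesgue_integral_def mult.commute)
qed

section \<open>Cutting a function where it vanishes\<close>
lemma is_weak_gradient_mult_test_function:
  fixes w g \<phi> :: "real \<Rightarrow> real"
  assumes w: "continuous_on UNIV w" and wg: "is_weak_gradient UNIV w g" and \<phi>: "test_function UNIV \<phi>"
  shows "is_weak_gradient UNIV (\<lambda>x. w x * \<phi> x) (\<lambda>x. w x * frechet_derivative \<phi> (at x) 1 + g x * \<phi> x)"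
  unfolding is_weak_gradient_def
proof (intro conjI allI impI ballI)
  let ?\<phi>' = "\<lambda>x. frechet_derivative \<phi> (at x) 1"
  have \<phi>0: "continuous_on UNIV \<phi>" and \<phi>1: "continuous_on UNIV ?\<phi>'"
    by (rule test_function_continuous[OF \<phi>]) (rule test_function_continuous_derivative[OF \<phi>], simp)
  have lg: "locally_integrable UNIV g" and lw: "locally_integrable UNIV w"
    using wg by (auto simp: is_weak_gradient_def)
  have "set_integrable lebesgue UNIV (\<lambda>x. g x * \<phi> x)"
    by (rule set_integrable_mult_test_function(1)[OF lg \<phi>])
  then have lg\<phi>: "locally_integrable UNIV (\<lambda>x. g x * \<phi> x)"
    unfolding locally_integrable_def
    by (auto intro: set_integrable_subset simp: compact_imp_closed lmeasurable_compact)
  have lw\<phi>': "locally_integrable UNIV (\<lambda>x. w x * ?\<phi>' x)"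
    by (intro locally_integrable_continuous continuous_intros w \<phi>1)
  show lw\<phi>: "locally_integrable UNIV (\<lambda>x. w x * \<phi> x)"
    by (intro locally_integrable_continuous continuous_intros w \<phi>0)
  show "locally_integrable UNIV (\<lambda>x. w x * ?\<phi>' x + g x * \<phi> x)"
    using lw\<phi>' lg\<phi> unfolding locally_integrable_def by auto
  fix \<psi> :: "real \<Rightarrow> real" and b :: real assume \<psi>: "test_function UNIV \<psi>" and "b \<in> Basis"
  then have b: "b = 1" by simp
  let ?\<psi>' = "\<lambda>x. frechet_derivative \<psi> (at x) 1"
  obtain K where K: "compact K" "\<And>x. x \<notin> K \<Longrightarrow> \<psi> x = 0"
    by (rule test_function_support[OF \<psi>]) blast
  have \<phi>\<psi>: "test_function UNIV (\<lambda>x. \<phi> x * \<psi> x)"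
  proof (rule test_functionI[OF _ K(1)])
    show "smooth_function (\<lambda>x. \<phi> x * \<psi> x)"
      using \<phi> \<psi> by (simp add: test_function_def smooth_function_def C_k_mult)
  qed (use K in auto)
  have D: "frechet_derivative (\<lambda>x. \<phi> x * \<psi> x) (at x) 1 = \<phi> x * ?\<psi>' x + ?\<phi>' x * \<psi> x" for x
    using frechet_derivative_at[OF has_derivative_mult[of \<phi> _ x UNIV \<psi>, OF
      test_function_differentiable[OF \<phi>, unfolded frechet_derivative_works]
      test_function_differentiable[OF \<psi>, unfolded frechet_derivative_works]]]
    by metis
  have i1: "integrable lebesgue (\<lambda>x. w x * \<phi> x * ?\<psi>' x)"
    using set_integrable_mult_test_function(2)[OF lw\<phi> \<psi>, of 1] by (simp add: set_integrable_def)
  have i2: "integrable lebesgue (\<lambda>x. w x * ?\<phi>' x * \<psi> x)"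
    using set_integrable_mult_test_function(1)[OF lw\<phi>' \<psi>] by (simp add: set_integrable_def)
  have i3: "integrable lebesgue (\<lambda>x. g x * \<phi> x * \<psi> x)"
    using set_integrable_mult_test_function(1)[OF lg\<phi> \<psi>] by (simp add: set_integrable_def)
  have "(LINT x|lebesgue. w x * frechet_derivative (\<lambda>x. \<phi> x * \<psi> x) (at x) 1)
     = - (LINT x|lebesgue. g x * (\<phi> x * \<psi> x))"
    by (rule weak_derivative_identity[OF wg \<phi>\<psi>])
  then have "(LINT x|lebesgue. w x * \<phi> x * ?\<psi>' x + w x * ?\<phi>' x * \<psi> x) = - (LINT x|lebesgue. g x * \<phi> x * \<psi> x)"
    by (simp add: D distrib_left mult.assoc)
  then have "(LINT x|lebesgue. w x * \<phi> x * ?\<psi>' x) =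
      - ((LINT x|lebesgue. w x * ?\<phi>' x * \<psi> x) + (LINT x|lebesgue. g x * \<phi> x * \<psi> x))"
    by (simp add: i1 i2)
  also have "\<dots> = - (LINT x|lebesgue. w x * ?\<phi>' x * \<psi> x + g x * \<phi> x * \<psi> x)"
    by (simp add: i2 i3)
  finally show "(LINT x:UNIV|lebesgue. w x * \<phi> x * frechet_derivative \<psi> (at x) b) =
     - (LINT x:UNIV|lebesgue. ((w x * ?\<phi>' x + g x * \<phi> x) \<bullet> b) * \<psi> x)"
    by (simp add: set_lebesgue_integral_def b distrib_right)
qed

text \<open>The enumeration of a finite \<open>D\<close> repeats sets; making it disjoint turns the repetitions into empty
  sets.\<close>
lemma integral_zero_countable_disjoint_union:
  fixes G :: "'a \<Rightarrow> 'b::{banach, second_countable_topology}"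
  assumes D: "countable D" "pairwise disjnt D" and meas: "\<And>X. X \<in> D \<Longrightarrow> X \<in> sets M"
    and int: "set_integrable M (\<Union>D) G" and zero: "\<And>X. X \<in> D \<Longrightarrow> (LINT x:X|M. G x) = 0"
  shows "(LINT x:\<Union>D|M. G x) = 0"
proof (cases "D = {}")
  case False
  define A where "A = disjointed (from_nat_into D)"
  have inD: "from_nat_into D i \<in> D" for i by (rule from_nat_into[OF False])
  have A_cases: "A n = from_nat_into D n \<or> A n = {}" for n
  proof (cases "\<exists>i<n. from_nat_into D i = from_nat_into D n")
    case True
    then have "A n = {}" by (auto simp: A_def disjointed_def)
    then show ?thesis ..
  next
    case no: False
    have "from_nat_into D i \<inter> from_nat_into D n = {}" if "i < n" for i
      using D(2) inD no that unfolding pairwise_def disjnt_def by metis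
    then have "A n = from_nat_into D n" unfolding A_def disjointed_def by fastforce
    then show ?thesis ..
  qed
  have "(\<Union>i. A i) = \<Union>D"
    unfolding A_def UN_disjointed_eq using D(1) False by (simp add: range_from_nat_into)
  moreover have "(LINT x:(\<Union>i. A i)|M. G x) = (\<Sum>i. LINT x:A i|M. G x)"
  proof (rule lebesgue_integral_countable_add)
    show "A i \<in> sets M" for i using A_cases[of i] meas[OF inD] by auto
    show "A i \<inter> A j = {}" if "i \<noteq> j" for i j
      using disjoint_family_disjointed[of "from_nat_into D"] that
      by (auto simp: A_def disjoint_family_on_def)
    show "set_integrable M (\<Union>i. A i) G" using int \<open>(\<Union>i. A i) = \<Union>D\<close> by simp
  qed
  moreover have "(LINT x:A i|M. G x) = 0" for i
    using A_cases[of i] zero[OF inD, of i] by (auto simp: set_lebesgue_integral_def)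
  ultimately show ?thesis by simp
qed (simp add: set_lebesgue_integral_def)

text \<open>A component is an open interval; an endpoint inside \<open>U\<close> could be added to it without losing
  connectedness, against maximality.\<close>
lemma bounded_open_component_real:
  fixes U :: "real set"
  assumes U: "open U" "bounded U" and C: "C \<in> components U"
  obtains a b where "a < b" "C = {a<..<b}" "a \<in> frontier U" "b \<in> frontier U"
proof -
  have "open C" using open_components[OF U(1) C] .
  have "C \<noteq> {}" "connected C" "C \<subseteq> U"
    using C in_components_nonempty in_components_connected in_components_subset by blast+
  have "bounded C" using U(2) \<open>C \<subseteq> U\<close> bounded_subset by blast
  then have bdd: "bdd_above C" "bdd_below C" by (auto intro: bounded_imp_bdd_above bounded_imp_bdd_below)
  define a b where "a = Inf C" and "b = Sup C"
  have "C = {a<..<b}"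
  proof (intro set_eqI iffI)
    fix x assume x: "x \<in> C"
    then obtain e where e: "e > 0" "ball x e \<subseteq> C" using \<open>open C\<close> open_contains_ball by blast
    then have "x - e / 2 \<in> C" "x + e / 2 \<in> C" by (auto simp: dist_real_def subset_iff)
    then have "a \<le> x - e / 2" "x + e / 2 \<le> b"
      unfolding a_def b_def using bdd by (auto intro: cInf_lower cSup_upper)
    then show "x \<in> {a<..<b}" using e(1) by simp
  next
    fix x assume "x \<in> {a<..<b}"
    then have "Inf C < x" "x < Sup C" by (simp_all add: a_def b_def)
    then obtain y z where "y \<in> C" "y < x" "z \<in> C" "x < z"
      using cInf_less_iff[OF \<open>C \<noteq> {}\<close> bdd(2)] less_cSup_iff[OF \<open>C \<noteq> {}\<close> bdd(1)] by blast
    then show "x \<in> C" using \<open>connected C\<close> unfolding connected_iff_interval by (metis less_imp_le)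
  qed
  moreover from this have "a < b" using \<open>C \<noteq> {}\<close> by auto
  moreover have "p \<in> frontier U" if "p = a \<or> p = b" for p
  proof -
    have "p \<in> closure C" using that \<open>C = {a<..<b}\<close> \<open>a < b\<close> by auto
    then have "p \<in> closure U" using closure_mono[OF \<open>C \<subseteq> U\<close>] by auto
    moreover have "p \<notin> U"
    proof
      assume "p \<in> U"
      have "insert p C \<subseteq> C"
      proof (rule components_maximal[OF C])
        show "connected (insert p C)"
          by (rule connected_intermediate_closure[OF \<open>connected C\<close>])
            (use \<open>p \<in> closure C\<close> closure_subset[of C] in auto)
      qed (use \<open>p \<in> U\<close> \<open>C \<subseteq> U\<close> \<open>C \<noteq> {}\<close> in auto)
      then show False using that \<open>C = {a<..<b}\<close> by auto
    qed
    ultimately show ?thesis using U(1) by (simp add: frontier_def interior_open)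
  qed
  ultimately show ?thesis using that by blast
qed

text \<open>On each component of \<open>U\<close> the integral of \<open>G\<close> is the difference of the values of \<open>F\<close> at two points
  of the frontier.  There are countably many components.\<close>
lemma integral_weak_derivative_open_set:
  fixes F G :: "real \<Rightarrow> real"
  assumes F: "continuous_on UNIV F" "is_weak_gradient UNIV F G"
    and U: "open U" "bounded U" and zero: "\<And>x. x \<in> frontier U \<Longrightarrow> F x = 0"
  shows "(LINT x:U|lebesgue. G x) = 0"
proof -
  have "pairwise disjnt (components U)"
    using pairwise_disjoint_components[of U] unfolding pairwise_def disjnt_def by simp
  moreover have opn: "open C" if "C \<in> components U" for C using open_components[OF U(1) that] .
  moreover have "set_integrable lebesgue U G"
  proof (rule set_integrable_subset)
    have "compact (closure U)" using U(2) by (simp add: compact_closure)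
    then show "set_integrable lebesgue (closure U) G"
      using F(2) by (simp add: is_weak_gradient_def locally_integrable_def)
  qed (use U(1) closure_subset in auto)
  moreover have "(LINT x:C|lebesgue. G x) = 0" if C: "C \<in> components U" for C
  proof -
    obtain a b where "a < b" "C = {a<..<b}" "a \<in> frontier U" "b \<in> frontier U"
      by (rule bounded_open_component_real[OF U C])
    then show ?thesis using weak_derivative_FTC[OF F \<open>a < b\<close>] zero by simp
  qed
  ultimately have "(LINT x:\<Union>(components U)|lebesgue. G x) = 0"
    by (intro integral_zero_countable_disjoint_union countable_disjoint_open_subsets) auto
  then show ?thesis by simp
qed

text \<open>Cutting creates no singular part in the derivative because \<open>h\<close> vanishes where it is cut.  For a
  test function \<open>\<phi>\<close> supported in a ball, the product of \<open>h\<close> and \<open>\<phi>\<close> vanishes on the frontier of the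
  intersection of \<open>A\<close> with the ball, so the weak derivative of this
  product has integral \<open>0\<close> over that intersection, which is the required identity.\<close>
lemma is_weak_gradient_cut:
  fixes h g :: "real \<Rightarrow> real"
  assumes h: "continuous_on UNIV h" "is_weak_gradient UNIV h g"
    and A: "open A" and zero: "\<And>x. x \<in> frontier A \<Longrightarrow> h x = 0"
  shows "is_weak_gradient UNIV (\<lambda>x. indicator A x * h x) (\<lambda>x. indicator A x * g x)"
  unfolding is_weak_gradient_def
proof (intro conjI allI impI ballI)
  have cut: "locally_integrable UNIV (\<lambda>x. indicator A x * f x)" if f: "locally_integrable UNIV f" for f :: "real \<Rightarrow> real"
    unfolding locally_integrable_def
  proof (intro allI impI)
    fix K :: "real set" assume "compact K"
    then have "integrable lebesgue (\<lambda>x. indicator K x *\<^sub>R f x)"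
      using f by (simp add: locally_integrable_def set_integrable_def)
    from integrable_mult_indicator[OF _ this, of A] A
    show "set_integrable lebesgue K (\<lambda>x. indicator A x * f x)"
      by (simp add: set_integrable_def mult.left_commute)
  qed
  have lh: "locally_integrable UNIV h" and lg: "locally_integrable UNIV g"
    using h(2) by (auto simp: is_weak_gradient_def)
  show "locally_integrable UNIV (\<lambda>x. indicator A x * h x)"
    "locally_integrable UNIV (\<lambda>x. indicator A x * g x)"
    using cut lh lg by blast+
  fix \<phi> :: "real \<Rightarrow> real" and b :: real assume \<phi>: "test_function UNIV \<phi>" and "b \<in> Basis"
  then have b: "b = 1" by simp
  let ?\<phi>' = "\<lambda>x. frechet_derivative \<phi> (at x) 1"
  obtain K where K: "compact K" "\<And>x. x \<notin> K \<Longrightarrow> \<phi> x = 0" "\<And>x. x \<notin> K \<Longrightarrow> ?\<phi>' x = 0"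
    by (rule test_function_support[OF \<phi>]) blast
  obtain R where "K \<subseteq> ball 0 R"
    using bounded_subset_ballD[OF compact_imp_bounded[OF K(1)]] by blast
  define U where "U = A \<inter> ball 0 R"
  have off: "\<phi> x = 0" "?\<phi>' x = 0" if "x \<notin> ball 0 R" for x
    using K(2,3) \<open>K \<subseteq> ball 0 R\<close> that by blast+
  have "(LINT x:U|lebesgue. h x * ?\<phi>' x + g x * \<phi> x) = 0"
  proof (rule integral_weak_derivative_open_set[OF _ is_weak_gradient_mult_test_function[OF h \<phi>]])
    show "continuous_on UNIV (\<lambda>x. h x * \<phi> x)"
      by (intro continuous_intros h test_function_continuous[OF \<phi>])
    show "open U" "bounded U" unfolding U_def using A by auto
    fix x assume "x \<in> frontier U"
    then have "x \<in> closure U" "x \<notin> U" using \<open>open U\<close> by (auto simp: frontier_def interior_open)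
    moreover have "closure U \<subseteq> closure A" unfolding U_def by (intro closure_mono) auto
    ultimately have "x \<notin> ball 0 R \<or> x \<in> frontier A"
      using A by (auto simp: frontier_def interior_open U_def)
    then show "h x * \<phi> x = 0" using zero off by auto
  qed
  also have "(LINT x:U|lebesgue. h x * ?\<phi>' x + g x * \<phi> x)
     = (LINT x|lebesgue. indicator A x * h x * ?\<phi>' x + indicator A x * g x * \<phi> x)"
    unfolding set_lebesgue_integral_def
    by (rule Bochner_Integration.integral_cong) (use off in \<open>auto simp: U_def indicator_def\<close>)
  also have "\<dots> = (LINT x|lebesgue. indicator A x * h x * ?\<phi>' x) + (LINT x|lebesgue. indicator A x * g x * \<phi> x)"
    using set_integrable_mult_test_function(2)[OF cut[OF lh] \<phi>, of 1]
      set_integrable_mult_test_function(1)[OF cut[OF lg] \<phi>]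
    by (intro Bochner_Integration.integral_add) (simp_all add: set_integrable_def)
  finally show "(LINT x:UNIV|lebesgue. indicator A x * h x * frechet_derivative \<phi> (at x) b) =
     - (LINT x:UNIV|lebesgue. ((indicator A x * g x) \<bullet> b) * \<phi> x)"
    by (simp add: set_lebesgue_integral_def b)
qed

lemma continuous_cut:
  fixes h :: "real \<Rightarrow> real"
  assumes h: "continuous_on UNIV h" and A: "open A" and zero: "\<And>x. x \<in> frontier A \<Longrightarrow> h x = 0"
  shows "continuous_on UNIV (\<lambda>x. indicator A x * h x)"
proof -
  have "continuous_on (closure A) (\<lambda>x. indicator A x * h x)"
    by (rule continuous_on_eq[OF continuous_on_subset[OF h]])
      (use zero A in \<open>auto simp: indicator_def frontier_def interior_open\<close>)
  moreover have "continuous_on (- A) (\<lambda>x. indicator A x * h x)"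
    by (rule continuous_on_eq[OF continuous_on_const[of _ 0]]) auto
  ultimately have "continuous_on (closure A \<union> - A) (\<lambda>x. indicator A x * h x)"
    using A by (intro continuous_on_closed_Un) auto
  moreover have "closure A \<union> - A = UNIV" using closure_subset by blast
  ultimately show ?thesis by simp
qed

lemma Omega_cut: "Omega (\<lambda>x. indicator A x * h x) = Omega h \<inter> (A \<times> UNIV)"
proof -
  have "0 < y \<and> y < indicator A x * h x \<longleftrightarrow> 0 < y \<and> y < h x \<and> x \<in> A" for x y
    by (cases "x \<in> A") auto
  then show ?thesis by (auto simp: Omega_def)
qed

lemma in_L2_subset:
  assumes f: "in_L2 S f" and T: "T \<in> sets lebesgue" "T \<subseteq> S"
  shows "in_L2 T f"
proof -
  have "(\<lambda>x. indicator T x *\<^sub>R (indicator S x *\<^sub>R f x)) \<in> borel_measurable lebesgue"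
    by (rule borel_measurable_scaleR[OF borel_measurable_indicator])
      (use f T in \<open>auto simp: in_L2_def set_borel_measurable_def\<close>)
  moreover have "indicator T x *\<^sub>R (indicator S x *\<^sub>R f x) = indicator T x *\<^sub>R f x" for x
    using T by (auto simp: indicator_def)
  ultimately have "set_borel_measurable lebesgue T f"
    by (simp only: set_borel_measurable_def)
  then show ?thesis
    using f T set_integrable_subset[of lebesgue S "\<lambda>x. (norm (f x))\<^sup>2" T] unfolding in_L2_def by blast
qed

lemma in_L2_cut:
  fixes f :: "real \<Rightarrow> real"
  assumes f: "in_L2 UNIV f" and A: "A \<in> sets lebesgue"
  shows "in_L2 UNIV (\<lambda>x. indicator A x * f x)"
proof -
  have "(norm (indicator A x * f x))\<^sup>2 = indicator A x * (norm (f x))\<^sup>2" for x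
    by (simp add: indicator_def)
  then show ?thesis
    using in_L2_subset[OF f A] by (simp add: in_L2_def set_borel_measurable_def set_integrable_def)
qed

text \<open>The condition on the frontier of \<open>A\<close> keeps the cut profile continuous and in \<open>H\<^sup>1\<close>.  Rectangles below
  the cut profile also lie below \<open>h\<close>, so the traces are inherited.\<close>
lemma admissible_cut:
  assumes uh: "(u, h) \<in> admissible V" and A: "open A" and zero: "\<And>x. x \<in> frontier A \<Longrightarrow> h x = 0"
  shows "(u, \<lambda>x. indicator A x * h x) \<in> admissible (LINT x|lebesgue. indicator A x * h x)"
proof -
  have h: "in_H1 UNIV h" "continuous_on UNIV h" "\<And>x. 0 \<le> h x" "has_bochner_integral lebesgue h V"
    and u: "in_H1 (Omega h) u"
    and tr: "\<And>a b d. a < b \<Longrightarrow> 0 < d \<Longrightarrow> {a<..<b} \<times> {0<..<d} \<subseteq> Omega h \<Longrightarrow> has_bottom_trace a b d u (\<lambda>x. x)"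
    using uh by (auto simp: admissible_def)
  let ?k = "\<lambda>x. indicator A x * h x"
  have Al: "A \<in> sets lebesgue" using A by simp
  have cont: "continuous_on UNIV ?k" by (rule continuous_cut[OF h(2) A zero])
  have sub: "Omega ?k \<subseteq> Omega h" by (auto simp: Omega_cut)
  have Ol: "Omega ?k \<in> sets lebesgue" using open_Omega[OF cont] by simp
  obtain g where g: "is_weak_gradient UNIV h g" "in_L2 UNIV g" and hL: "in_L2 UNIV h"
    using h(1) by (auto simp: in_H1_def)
  have "in_H1 UNIV ?k"
    using is_weak_gradient_cut[OF h(2) g(1) A zero] in_L2_cut[OF g(2) Al] in_L2_cut[OF hL Al]
    unfolding in_H1_def by blast
  moreover have "in_H1 (Omega ?k) u"
  proof -
    obtain k where k: "is_weak_gradient (Omega h) u k" "in_L2 (Omega h) k" and uL: "in_L2 (Omega h) u"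
      using u by (auto simp: in_H1_def)
    from is_weak_gradient_subset[OF k(1) sub] in_L2_subset[OF k(2) Ol sub] in_L2_subset[OF uL Ol sub]
    show ?thesis unfolding in_H1_def by blast
  qed
  moreover have "has_bochner_integral lebesgue ?k (LINT x|lebesgue. ?k x)"
    using h(4) integrable_mult_indicator[OF Al, of h] by (simp add: has_bochner_integral_iff)
  ultimately show ?thesis
    using cont h(3) tr sub by (auto simp: admissible_def)
qed

section \<open>Energies and the contradiction\<close>
lemma energy_nonneg: "0 \<le> bulk_energy u h" "0 \<le> surface_energy h"
  unfolding bulk_energy_def surface_energy_def dirichlet_energy_def set_lebesgue_integral_def
  by (auto intro!: Bochner_Integration.integral_nonneg)

lemma F_s_le: "(u, h) \<in> admissible V \<Longrightarrow> F_s V \<le> bulk_energy u h + surface_energy h"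
  unfolding F_s_def
  by (rule cINF_lower2[of _ _ "(u, h)"])
    (auto intro!: bdd_belowI[of _ 0] add_nonneg_nonneg energy_nonneg)

text \<open>A profile without surface energy has weak derivative \<open>0\<close> almost everywhere and is constant by
  the fundamental theorem of calculus.\<close>
lemma surface_energy_pos:
  assumes uh: "(u, h) \<in> admissible V" and pq: "h p \<noteq> h q"
  shows "0 < surface_energy h"
proof -
  obtain g where g: "is_weak_gradient UNIV h g" "in_L2 UNIV g" and cont: "continuous_on UNIV h"
    using uh by (auto simp: admissible_def in_H1_def)
  have eq: "surface_energy h = (LINT x|lebesgue. (g x)\<^sup>2)"
    using dirichlet_energy_eq[OF open_UNIV g(1)] by (simp add: surface_energy_def set_lebesgue_integral_def)
  have int: "integrable lebesgue (\<lambda>x. (g x)\<^sup>2)" using g(2) by (simp add: in_L2_def set_integrable_def)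
  have "surface_energy h \<noteq> 0"
  proof
    assume "surface_energy h = 0"
    then have "AE x in lebesgue. g x = 0"
      using integral_nonneg_eq_0_iff_AE[OF int] by (simp add: eq)
    then have "(LINT x:S|lebesgue. g x) = 0" for S
      unfolding set_lebesgue_integral_def by (intro integral_eq_zero_AE, eventually_elim) simp
    then have "h a = h b" if "a < b" for a b
      using weak_derivative_FTC[OF cont g(1) that] by simp
    then show False using pq by (metis linorder_neqE_linordered_idom)
  qed
  then show ?thesis using energy_nonneg(2)[of h] by linarith
qed

lemma volume_pos:
  fixes k :: "real \<Rightarrow> real"
  assumes "continuous_on UNIV k" "\<And>x. 0 \<le> k x" "has_bochner_integral lebesgue k V" "k p > 0"
  shows "V > 0"
proof -
  have int: "integrable lebesgue k" and V: "V = (LINT x|lebesgue. k x)"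
    using assms(3) by (auto simp: has_bochner_integral_iff)
  have "V \<noteq> 0"
  proof
    assume "V = 0"
    then have "AE x in lebesgue. k x = 0"
      using integral_nonneg_eq_0_iff_AE[OF int] assms(2) V by auto
    then have "AE x in lebesgue. x \<in> {x. k x = 0}" by simp
    moreover have "closed {x. k x = 0}"
      by (intro closed_Collect_eq assms(1) continuous_on_const)
    ultimately have "p \<in> {x. k x = 0}" by (intro mem_closed_if_AE_lebesgue)
    then show False using assms(4) by simp
  qed
  then show ?thesis using V Bochner_Integration.integral_nonneg[of lebesgue k, OF assms(2)] by linarith
qed

text \<open>Dilation by \<open>c = sqrt (V / W) > 1\<close> turns a
  competitor for the volume \<open>W\<close> into one for \<open>V\<close>.  Its bulk energy grows like the volume, by
  \<open>c\<^sup>2 = V / W\<close>, but its surface energy grows only by \<open>c < c\<^sup>2\<close>.\<close>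
lemma F_s_less_scaled_energy:
  assumes uh: "(u, h) \<in> admissible W" and W: "0 < W" "W < V" and S: "0 < surface_energy h"
  shows "W * F_s V < V * (bulk_energy u h + surface_energy h)"
proof -
  define c where "c = sqrt (V / W)"
  have c2: "c\<^sup>2 = V / W" and c1: "c > 1" using W by (simp_all add: c_def)
  have c: "c > 0" and "c < c\<^sup>2" using c1 by (auto simp: power2_eq_square)
  have "(dilate c u, dilate c h) \<in> admissible V"
    using admissible_dilate[OF c uh] c2 W by simp
  then have "F_s V \<le> c\<^sup>2 * bulk_energy u h + c * surface_energy h"
    using F_s_le bulk_energy_dilate[OF c uh] surface_energy_dilate[OF c uh] by metis
  also have "\<dots> < c\<^sup>2 * bulk_energy u h + c\<^sup>2 * surface_energy h"
    using S \<open>c < c\<^sup>2\<close> by simp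
  finally have "F_s V < (V / W) * (bulk_energy u h + surface_energy h)" by (simp add: c2 distrib_left)
  then show ?thesis using W by (simp add: field_simps)
qed

text \<open>The region below \<open>h\<close> is the disjoint union of the regions below the two pieces.  For the surface
  energies an inequality suffices, and it avoids deciding what the derivative of \<open>h\<close> does on the zero
  set of \<open>h\<close>.\<close>
lemma energies_split:
  assumes uh: "(u, h) \<in> admissible V" and A: "open A" and B: "open B"
    and AB: "A \<inter> B = {}" "{x. h x > 0} = A \<union> B"
    and zA: "\<And>x. x \<in> frontier A \<Longrightarrow> h x = 0" and zB: "\<And>x. x \<in> frontier B \<Longrightarrow> h x = 0"
  defines "h1 \<equiv> \<lambda>x. indicator A x * h x" and "h2 \<equiv> \<lambda>x. indicator B x * h x"
  shows "bulk_energy u h = bulk_energy u h1 + bulk_energy u h2"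
    and "surface_energy h1 + surface_energy h2 \<le> surface_energy h"
proof -
  have cont: "continuous_on UNIV h" using uh by (simp add: admissible_def)
  have O1: "open (Omega h1)" and O2: "open (Omega h2)"
    unfolding h1_def h2_def by (intro open_Omega continuous_cut cont A B zA zB; assumption)+
  have sub: "Omega h1 \<subseteq> Omega h" "Omega h2 \<subseteq> Omega h" by (auto simp: h1_def h2_def Omega_cut)
  have pos: "x \<in> A \<union> B" if "(x, y) \<in> Omega h" for x y
    using that AB(2) by (force simp: Omega_def)
  have Un: "Omega h = Omega h1 \<union> Omega h2" and Int: "Omega h1 \<inter> Omega h2 = {}"
    using pos AB(1) by (auto simp: h1_def h2_def Omega_cut)
  obtain g where g: "is_weak_gradient (Omega h) u g" "in_L2 (Omega h) g"
    using uh by (auto simp: admissible_def in_H1_def)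
  have gi: "set_integrable lebesgue (Omega h) (\<lambda>x. (norm (g x))\<^sup>2)" using g(2) by (simp add: in_L2_def)
  have "(LINT x:Omega h|lebesgue. (norm (g x))\<^sup>2) =
      (LINT x:Omega h1|lebesgue. (norm (g x))\<^sup>2) + (LINT x:Omega h2|lebesgue. (norm (g x))\<^sup>2)"
    unfolding Un
    by (rule set_integral_Un[OF Int]) (rule set_integrable_subset[OF gi]; use O1 O2 sub in simp)+
  then show "bulk_energy u h = bulk_energy u h1 + bulk_energy u h2"
    unfolding bulk_energy_def
    by (simp add: dirichlet_energy_eq[OF open_Omega[OF cont] g(1)]
        dirichlet_energy_eq[OF O1 is_weak_gradient_subset[OF g(1) sub(1)]]
        dirichlet_energy_eq[OF O2 is_weak_gradient_subset[OF g(1) sub(2)]])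
  obtain k where k: "is_weak_gradient UNIV h k" "in_L2 UNIV k"
    using uh by (auto simp: admissible_def in_H1_def)
  have ki: "integrable lebesgue (\<lambda>x. (k x)\<^sup>2)" using k(2) by (simp add: in_L2_def set_integrable_def)
  have kA: "integrable lebesgue (\<lambda>x. indicator A x * (k x)\<^sup>2)"
    and kB: "integrable lebesgue (\<lambda>x. indicator B x * (k x)\<^sup>2)"
    using integrable_mult_indicator[OF _ ki, of A] integrable_mult_indicator[OF _ ki, of B] A B by simp_all
  have sq: "(indicator S x * k x)\<^sup>2 = indicator S x * (k x)\<^sup>2" for S x by (simp add: indicator_def)
  have "surface_energy h1 = (LINT x|lebesgue. indicator A x * (k x)\<^sup>2)"
    "surface_energy h2 = (LINT x|lebesgue. indicator B x * (k x)\<^sup>2)"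
    using dirichlet_energy_eq[OF open_UNIV is_weak_gradient_cut[OF cont k(1) A zA]]
      dirichlet_energy_eq[OF open_UNIV is_weak_gradient_cut[OF cont k(1) B zB]]
    by (simp_all add: surface_energy_def h1_def h2_def set_lebesgue_integral_def sq)
  then have "surface_energy h1 + surface_energy h2
      = (LINT x|lebesgue. indicator A x * (k x)\<^sup>2 + indicator B x * (k x)\<^sup>2)"
    by (simp add: kA kB)
  also have "\<dots> \<le> (LINT x|lebesgue. (k x)\<^sup>2)"
    by (rule integral_mono) (use kA kB ki AB(1) in \<open>auto simp: indicator_def\<close>)
  also have "\<dots> = surface_energy h"
    using dirichlet_energy_eq[OF open_UNIV k(1)] by (simp add: surface_energy_def set_lebesgue_integral_def)
  finally show "surface_energy h1 + surface_energy h2 \<le> surface_energy h" .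
qed

theorem proposition3p4:
  fixes V :: real and u :: "real \<times> real \<Rightarrow> real" and h :: "real \<Rightarrow> real"
  assumes "V > 0"
    and "(u, h) \<in> admissible V"
    and "F_s V = bulk_energy u h + surface_energy h"
  shows "connected {x. h x > 0}"
proof (rule ccontr)
  assume disc: "\<not> connected {x. h x > 0}"
  have cont: "continuous_on UNIV h" and nonneg: "\<And>x. 0 \<le> h x" and vol: "has_bochner_integral lebesgue h V"
    using assms(2) by (auto simp: admissible_def)
  let ?S = "{x. h x > 0}"
  have "open ?S" by (intro open_Collect_less cont continuous_on_const)
  obtain A' B' where sep: "open A'" "open B'" "?S \<subseteq> A' \<union> B'" "A' \<inter> B' \<inter> ?S = {}"
      "A' \<inter> ?S \<noteq> {}" "B' \<inter> ?S \<noteq> {}"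
    using disc unfolding connected_def by blast
  define A B where "A = A' \<inter> ?S" and "B = B' \<inter> ?S"
  have A: "open A" "A \<noteq> {}" and B: "open B" "B \<noteq> {}" and AB: "A \<inter> B = {}" "?S = A \<union> B"
    using sep \<open>open ?S\<close> unfolding A_def B_def by (auto intro: open_Int)
  have front: "h x = 0" if "open A'" "open B'" "A' \<inter> B' = {}" "{x. h x > 0} = A' \<union> B'" "x \<in> frontier A'"
    for A' B' x
  proof (rule ccontr)
    assume "h x \<noteq> 0"
    then have "x \<in> A' \<union> B'" using nonneg[of x] that(4) by force
    moreover have "x \<notin> A'" "x \<in> closure A'" using that by (auto simp: frontier_def interior_open)
    moreover have "closure A' \<inter> B' = {}" using that(2,3) by (simp add: open_Int_closure_eq_empty Int_commute)
    ultimately show False by blast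
  qed
  have zA: "h x = 0" if "x \<in> frontier A" for x
    by (rule front[OF A(1) B(1) AB that])
  have zB: "h x = 0" if "x \<in> frontier B" for x
    by (rule front[OF B(1) A(1) _ _ that]) (use AB in auto)
  define h1 h2 where "h1 x = indicator A x * h x" and "h2 x = indicator B x * h x" for x
  define V1 V2 where "V1 = (LINT x|lebesgue. h1 x)" and "V2 = (LINT x|lebesgue. h2 x)"
  have adm1: "(u, h1) \<in> admissible V1" and adm2: "(u, h2) \<in> admissible V2"
    using admissible_cut[OF assms(2) A(1) zA] admissible_cut[OF assms(2) B(1) zB]
    by (simp_all add: h1_def[abs_def] h2_def[abs_def] V1_def V2_def)
  have ind1: "has_bochner_integral lebesgue h1 V1" "continuous_on UNIV h1" "\<And>x. 0 \<le> h1 x"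
    and ind2: "has_bochner_integral lebesgue h2 V2" "continuous_on UNIV h2" "\<And>x. 0 \<le> h2 x"
    using adm1 adm2 by (auto simp: admissible_def)
  obtain p q where p: "p \<in> A" and q: "q \<in> B" using A B by blast
  then have hp: "h p > 0" "h q > 0" using AB by blast+
  have pq: "h1 p > 0" "h1 q = 0" "h2 q > 0" "h2 p = 0"
    using p q hp disjoint_iff[THEN iffD1, OF AB(1)] by (auto simp: h1_def h2_def indicator_def)
  have V1: "V1 > 0" and V2: "V2 > 0"
    using volume_pos[OF ind1(2,3,1) pq(1)] volume_pos[OF ind2(2,3,1) pq(3)] by auto
  have "h x = h1 x + h2 x" for x
    using AB nonneg[of x] by (force simp: h1_def h2_def indicator_def)
  then have "V = V1 + V2"
    using has_bochner_integral_add[OF ind1(1) ind2(1)] vol has_bochner_integral_eq[of lebesgue h]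
    by (metis (no_types, lifting) ext)
  let ?E1 = "bulk_energy u h1 + surface_energy h1" and ?E2 = "bulk_energy u h2 + surface_energy h2"
  have "V1 * F_s V < V * ?E1"
    by (rule F_s_less_scaled_energy[OF adm1 V1 _ surface_energy_pos[OF adm1, of p q]])
      (use V2 pq \<open>V = V1 + V2\<close> in auto)
  moreover have "V2 * F_s V < V * ?E2"
    by (rule F_s_less_scaled_energy[OF adm2 V2 _ surface_energy_pos[OF adm2, of p q]])
      (use V1 pq \<open>V = V1 + V2\<close> in auto)
  \<comment> \<open>Here \<open>V1 + V2 = V\<close> turns the sum of the left sides into \<open>V * F_s V\<close>.\<close>
  ultimately have "V * F_s V < V * (?E1 + ?E2)"
    unfolding \<open>V = V1 + V2\<close> by (simp add: algebra_simps)
  also have "\<dots> \<le> V * F_s V"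
    using energies_split[OF assms(2) A(1) B(1) AB zA zB] assms(1,3)
    unfolding h1_def[abs_def] h2_def[abs_def] by simp
  finally show False by simp
qed

end
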